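(* Let $\beta>1$ be such that $d_{-\beta}\!\left(\frac{-\beta}{\beta+1}\right)$ is eventually periodic and does not end in $0^\omega$, and suppose $\mathrm{Fin}(-\beta)=\mathbb{Z}[\beta]$. Then there exists a constant $\gamma>0$ with $(-\gamma,\gamma)\subseteq I_\beta$ such that every rational number $x\in(-\gamma,\gamma)$ has a purely periodic $(-\beta)$-expansion $d_{-\beta}(x)$.
   Context: For $\beta>1$ let $I_\beta=\left[-\frac{\beta}{\beta+1},\frac{1}{\beta+1}\right)$ and define $T_{-\beta}:I_\beta\to I_\beta$ by $T_{-\beta}(x)=-\beta x-\left\lfloor -\beta x+\frac{\beta}{\beta+1}\right\rfloor$. For $x\in I_\beta$ put $x_i=\left\lfloor -\beta T_{-\beta}^{i-1}(x)+\frac{\beta}{\beta+1}\right\rfloor\in\{0,\dots,\lfloor\beta\rfloor\}$; then $x=\sum_{i\ge1}x_i(-\beta)^{-i}$ and $d_{-\beta}(x):=x_1x_2\cdots$. It is purely periodic if $d_{-\beta}(x)=(a_1\cdots a_N)^\omega$ for some finite word. A digit string $y_1y_2\cdots$ is $(-\beta)$-admissible if $y_1y_2\cdots=d_{-\beta}(x)$ for some $x\in I_\beta$. Every real $x\ne0$ can be written uniquely as $x=\sum_{i\ge1}x_i(-\beta)^{n-i+1}$ with $n\in\mathbb{Z}$, $x_1\neq0$ and $0x_1x_2\cdots$ $(-\beta)$-admissible (the $(-\beta)$-expansion of $x$); $\mathrm{Fin}(-\beta)$ denotes the set of real numbers (including $0$) whose $(-\beta)$-expansion is finite, i.e. whose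 digit string ends in $0^\omega$. $\mathbb{Z}[\beta]$ is the ring of integer polynomials in $\beta$. *)

theory Defs
  imports
    "HOL-Analysis.Analysis"
    "HOL-Computational_Algebra.Polynomial"
    "HOL-Library.Omega_Words_Fun"
begin

text \<open>
  Digit strings are \<open>\<omega>\<close>-words indexed from 0, so \<open>s i\<close> is the digit with
  mathematical index \<open>i + 1\<close>.
\<close>

definition I_beta :: "real \<Rightarrow> real set" where
  "I_beta \<beta> = {- \<beta> / (\<beta> + 1) ..< 1 / (\<beta> + 1)}"

definition T_neg :: "real \<Rightarrow> real \<Rightarrow> real" where
  "T_neg \<beta> x = - \<beta> * x - of_int \<lfloor>- \<beta> * x + \<beta> / (\<beta> + 1)\<rfloor>"

definition d_neg :: "real \<Rightarrow> real \<Rightarrow> int word" where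
  "d_neg \<beta> x = (\<lambda>i. \<lfloor>- \<beta> * (T_neg \<beta> ^^ i) x + \<beta> / (\<beta> + 1)\<rfloor>)"

definition purely_periodic :: "'a word \<Rightarrow> bool" where
  "purely_periodic s \<longleftrightarrow> (\<exists>w. w \<noteq> [] \<and> s = w\<^sup>\<omega>)"

definition eventually_periodic :: "'a word \<Rightarrow> bool" where
  "eventually_periodic s \<longleftrightarrow> (\<exists>v w. w \<noteq> [] \<and> s = v \<frown> w\<^sup>\<omega>)"

definition ends_in_zeros :: "int word \<Rightarrow> bool" where
  "ends_in_zeros s \<longleftrightarrow> (\<exists>v. s = v \<frown> [0]\<^sup>\<omega>)"

definition neg_admissible :: "real \<Rightarrow> int word \<Rightarrow> bool" where
  "neg_admissible \<beta> s \<longleftrightarrow> (\<exists>x\<in>I_beta \<beta>. s = d_neg \<beta> x)"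

text \<open>
  \<open>is_neg_expansion \<beta> x n s\<close>: the string \<open>s\<close>, with leading exponent \<open>n\<close>, is the
  \<open>(-\<beta>)\<close>-expansion of the nonzero real \<open>x\<close>. The leading zero in the admissibility
  condition makes the pair \<open>(n, s)\<close> unique.
\<close>

definition is_neg_expansion :: "real \<Rightarrow> real \<Rightarrow> int \<Rightarrow> int word \<Rightarrow> bool" where
  "is_neg_expansion \<beta> x n s \<longleftrightarrow>
     s 0 \<noteq> 0 \<and> neg_admissible \<beta> ([0] \<frown> s) \<and>
     (\<lambda>i. of_int (s i) * (- \<beta>) powi (n - int i)) sums x"

definition Fin_neg :: "real \<Rightarrow> real set" where
  "Fin_neg \<beta> = {0} \<union> {x. x \<noteq> 0 \<and> (\<exists>n s. is_neg_expansion \<beta> x n s \<and> ends_in_zeros s)}"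

definition int_poly_ring :: "real \<Rightarrow> real set" where
  "int_poly_ring \<beta> = range (\<lambda>p :: int poly. poly (map_poly of_int p) \<beta>)"

end

theory Submission
  imports Defs "HOL-Computational_Algebra.Fundamental_Theorem_Algebra"
begin

text \<open>
  The hypothesis makes \<open>1 / \<beta>\<close> an element of \<open>\<int>[\<beta>]\<close>, and every element of \<open>\<int>[\<beta>]\<close> near \<open>0\<close> is sent
  to \<open>0\<close> by an iterate of \<open>T\<close>, so it is a polynomial in \<open>- 1 / \<beta>\<close> whose coefficients are its digits.

  Let \<open>z \<noteq> 1 / \<beta>\<close> be a conjugate of \<open>1 / \<beta>\<close>. If \<open>|z| < 1\<close>, digit polynomials are bounded at \<open>z\<close>,
  which fails for the fractional parts of the numbers \<open>k \<beta>\<close>. If \<open>|z| = 1\<close>, then \<open>\<beta>\<close> itself is a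
  conjugate of \<open>1 / \<beta>\<close> (the Salem case). Evaluating a digit polynomial at \<open>\<beta>\<close> gives the value of the
  reversed digit string, and admissibility keeps these values away from \<open>0\<close>, whereas \<open>\<int>[\<beta>]\<close> contains
  nonzero elements that are small both at \<open>1 / \<beta>\<close> and at \<open>\<beta>\<close>. Hence \<open>|z| > 1\<close>: \<open>\<beta>\<close> is a Pisot unit.

  For a rational \<open>x\<close> choose \<open>N\<close> such that \<open>w = x - x (- 1 / \<beta>)\<^sup>N\<close> lies in \<open>\<int>[\<beta>]\<close>. The points
  \<open>T\<^sup>N\<^sup>-\<^sup>K w\<close> have uniformly bounded conjugates when \<open>x\<close> is small in terms of \<open>K\<close>, so they form a
  finite set, and with a suitable \<open>K\<close> this yields \<open>T\<^sup>N w = 0\<close>. Since the orbit of the left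
  endpoint is finite and avoids \<open>0\<close>, preimages of \<open>0\<close> keep away from the endpoints, and adding the
  small number \<open>x (- 1 / \<beta>)\<^sup>N\<close> back to \<open>w\<close> does not change the first \<open>N\<close> digits. Thus \<open>T\<^sup>N x = x\<close>.
\<close>

subsection \<open>The transformation and its digits\<close>

locale neg_base =
  fixes \<beta> :: real
  assumes \<beta>_gt_1: "\<beta> > 1"
begin

abbreviation T :: "real \<Rightarrow> real" where "T \<equiv> T_neg \<beta>"
abbreviation I :: "real set" where "I \<equiv> I_beta \<beta>"
abbreviation lend :: real where "lend \<equiv> - \<beta> / (\<beta> + 1)"
abbreviation rend :: real where "rend \<equiv> 1 / (\<beta> + 1)"

definition digit :: "real \<Rightarrow> int" where
  "digit x = \<lfloor>- \<beta> * x + \<beta> / (\<beta> + 1)\<rfloor>"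

lemma rend_eq: "rend = lend + 1"
  using \<beta>_gt_1 by (simp add: field_simps)

lemma lend_lt_0: "lend < 0" and rend_gt_0: "rend > 0"
  using \<beta>_gt_1 by (simp_all add: field_simps)

lemma mem_I: "x \<in> I \<longleftrightarrow> lend \<le> x \<and> x < rend"
  by (auto simp: I_beta_def)

lemma zero_mem_I: "0 \<in> I"
  unfolding mem_I using lend_lt_0 rend_gt_0 by simp

lemma T_eq: "T x = - \<beta> * x - of_int (digit x)"
  by (simp add: T_neg_def digit_def)

lemma T_mem_I: "T x \<in> I"
proof -
  define t where "t = - \<beta> * x + \<beta> / (\<beta> + 1)"
  have "of_int \<lfloor>t\<rfloor> \<le> t" "t < of_int \<lfloor>t\<rfloor> + 1" by linarith+
  moreover have "T x = t - of_int \<lfloor>t\<rfloor> + lend"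
    by (simp add: T_neg_def t_def)
  ultimately show ?thesis unfolding mem_I using rend_eq by linarith
qed

text \<open>\<open>I\<close> is half-open of length 1, so exactly one integer translate of
  \<open>- \<beta> * x\<close> lies in it. Later evaluations of \<open>T\<close> rest on this
  uniqueness.\<close>

lemma digit_eqI:
  assumes "- \<beta> * x - of_int k \<in> I"
  shows "digit x = k"
  unfolding digit_def
proof (rule floor_unique)
  have "lend \<le> - \<beta> * x - of_int k" "- \<beta> * x - of_int k < lend + 1"
    using assms rend_eq by (simp_all add: mem_I)
  then show "of_int k \<le> - \<beta> * x + \<beta> / (\<beta> + 1)" "- \<beta> * x + \<beta> / (\<beta> + 1) < of_int k + 1"
    by simp_all
qed

lemma T_eqI:
  assumes "y \<in> I" "y = - \<beta> * x - of_int k"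
  shows "T x = y"
  using digit_eqI[of x k] assms by (simp add: T_eq)

lemma digit_zero: "digit 0 = 0"
  by (rule digit_eqI) (simp add: zero_mem_I)

lemma T_0: "T 0 = 0"
  by (rule T_eqI[where k = 0]) (simp_all add: zero_mem_I)

lemma funpow_T_0: "(T ^^ n) 0 = 0"
  by (induction n) (simp_all add: T_0)

lemma funpow_T_mem_I: "x \<in> I \<Longrightarrow> (T ^^ n) x \<in> I"
  by (induction n) (simp_all add: T_mem_I)

lemma funpow_T_zero_mono:
  assumes "(T ^^ m) x = 0" "m \<le> n"
  shows "(T ^^ n) x = 0"
proof -
  have "(T ^^ n) x = (T ^^ (n - m)) ((T ^^ m) x)"
    using assms(2) by (metis funpow_add le_add_diff_inverse2 o_apply)
  then show ?thesis using assms(1) funpow_T_0 by simp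
qed

lemma d_neg_eq: "d_neg \<beta> x i = digit ((T ^^ i) x)"
  by (simp add: d_neg_def digit_def)

lemma digit_bounds:
  assumes "x \<in> I"
  shows "0 \<le> digit x" "of_int (digit x) \<le> \<beta>"
proof -
  have l: "lend \<le> x" and r: "x < rend" using assms by (simp_all add: mem_I)
  have "\<beta> * x < \<beta> * rend" using r \<beta>_gt_1 by (intro mult_strict_left_mono) auto
  then have "- \<beta> * x + \<beta> / (\<beta> + 1) > 0" by simp
  then show "0 \<le> digit x" by (simp add: digit_def)
  have "- \<beta> * x \<le> - \<beta> * lend" using l \<beta>_gt_1 by (intro mult_left_mono_neg) auto
  moreover have "- \<beta> * lend + \<beta> / (\<beta> + 1) = \<beta>"
    using \<beta>_gt_1 by (simp add: divide_simps) (simp add: algebra_simps)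
  ultimately have "- \<beta> * x + \<beta> / (\<beta> + 1) \<le> \<beta>" by linarith
  then show "of_int (digit x) \<le> \<beta>"
    unfolding digit_def by (meson of_int_floor_le order_trans)
qed

lemma small_mem_I:
  assumes "\<bar>x\<bar> < rend"
  shows "x \<in> I"
proof -
  have "lend \<le> - rend" using \<beta>_gt_1 by (simp add: field_simps)
  then show ?thesis using assms by (auto simp: mem_I)
qed

end

section \<open>Evaluation of integer polynomials in commutative rings\<close>

abbreviation ipoly :: "int poly \<Rightarrow> 'a::comm_ring_1 \<Rightarrow> 'a" where
  "ipoly p z \<equiv> poly (map_poly of_int p) z"

lemma ipoly_simps [simp]:
  "ipoly 0 z = 0"
  "ipoly (p + q) z = ipoly p z + ipoly q z"
  "ipoly (p - q) z = ipoly p z - ipoly q z"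
  "ipoly (- p) z = - ipoly p z"
  "ipoly (pCons a p) z = of_int a + z * ipoly p z"
  "ipoly (smult a p) z = of_int a * ipoly p z"
proof -
  have "map_poly (of_int :: int \<Rightarrow> 'a) (p + q) = map_poly of_int p + map_poly of_int q"
    "map_poly (of_int :: int \<Rightarrow> 'a) (p - q) = map_poly of_int p - map_poly of_int q"
    "map_poly (of_int :: int \<Rightarrow> 'a) (- p) = - map_poly of_int p"
    "map_poly (of_int :: int \<Rightarrow> 'a) (pCons a p) = pCons (of_int a) (map_poly of_int p)"
    "map_poly (of_int :: int \<Rightarrow> 'a) (smult a p) = smult (of_int a) (map_poly of_int p)"
    by (rule poly_eqI; simp add: coeff_map_poly coeff_pCons split: nat.split)+
  then show "ipoly 0 z = 0"
    "ipoly (p + q) z = ipoly p z + ipoly q z"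
    "ipoly (p - q) z = ipoly p z - ipoly q z"
    "ipoly (- p) z = - ipoly p z"
    "ipoly (pCons a p) z = of_int a + z * ipoly p z"
    "ipoly (smult a p) z = of_int a * ipoly p z"
    by simp_all
qed

lemma ipoly_1 [simp]: "ipoly 1 z = 1"
  by (simp add: one_pCons)

lemma ipoly_mult [simp]: "ipoly (p * q) z = ipoly p z * ipoly q z"
  by (induction p) (simp_all add: algebra_simps)

lemma ipoly_power [simp]: "ipoly (p ^ n) z = ipoly p z ^ n"
  by (induction n) simp_all

lemma ipoly_of_real: "ipoly p (of_real x :: complex) = of_real (ipoly p x)"
  by (induction p) simp_all

section \<open>Digit polynomials and their size at conjugates\<close>

context neg_base
begin

text \<open>If x_1, x_2, ... are the digits of x, this is the sum of x_i (-X)^i over 1 <= i <= n.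
  The indeterminate stands for 1/\<beta>, so the polynomial can also be evaluated at conjugates of
  1/\<beta> and at \<beta> itself.\<close>

primrec dpoly :: "nat \<Rightarrow> real \<Rightarrow> int poly" where
  "dpoly 0 x = 0"
| "dpoly (Suc n) x = - pCons 0 ([:digit x:] + dpoly n (T x))"

lemma dpoly_0: "dpoly n 0 = 0"
proof (induction n)
  case (Suc n)
  then show ?case using digit_zero T_0 by simp
qed simp

lemma ipoly_dpoly: "x = ipoly (dpoly n x) (1 / \<beta>) + (- 1 / \<beta>) ^ n * (T ^^ n) x"
proof (induction n arbitrary: x)
  case (Suc n)
  define s where "s = (- 1 / \<beta>) ^ n * (T ^^ n) (T x)"
  have "T x = ipoly (dpoly n (T x)) (1 / \<beta>) + s"
    unfolding s_def by (rule Suc)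
  then have "- \<beta> * x - of_int (digit x) = ipoly (dpoly n (T x)) (1 / \<beta>) + s"
    by (simp add: T_eq)
  then have "x = - (1 / \<beta>) * (of_int (digit x) + ipoly (dpoly n (T x)) (1 / \<beta>) + s)"
    using \<beta>_gt_1 by (simp add: field_simps)
  then show ?case unfolding s_def
    by (simp add: funpow_swap1 algebra_simps)
qed simp

lemma norm_ipoly_dpoly_Suc:
  fixes z :: complex
  shows "norm (ipoly (dpoly (Suc n) x) z) = norm z * norm (of_int (digit x) + ipoly (dpoly n (T x)) z)"
proof -
  have "ipoly (dpoly (Suc n) x) z = - (z * (of_int (digit x) + ipoly (dpoly n (T x)) z))"
    by (simp add: algebra_simps)
  then show ?thesis by (simp only: norm_minus_cancel norm_mult)
qed

text \<open>Digits lie between 0 and \<beta>, so the geometric series \<beta> (|z| + |z|^2 + ...)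
  dominates.\<close>

lemma ipoly_dpoly_conj_bound:
  fixes z :: complex
  assumes "x \<in> I" "norm z < 1"
  shows "norm (ipoly (dpoly n x) z) \<le> \<beta> * norm z / (1 - norm z)"
  using assms(1)
proof (induction n arbitrary: x)
  case 0
  then show ?case using assms \<beta>_gt_1 by simp
next
  case (Suc n)
  have d: "norm (of_int (digit x) :: complex) \<le> \<beta>"
    using digit_bounds[OF Suc.prems] by simp
  have "norm (ipoly (dpoly (Suc n) x) z) = norm z * norm (of_int (digit x) + ipoly (dpoly n (T x)) z)"
    by (simp only: norm_ipoly_dpoly_Suc)
  also have "\<dots> \<le> norm z * (\<beta> + \<beta> * norm z / (1 - norm z))"
    by (intro mult_left_mono order_trans[OF norm_triangle_ineq] add_mono d Suc.IH T_mem_I) simp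
  also have "\<dots> = \<beta> * norm z / (1 - norm z)"
    using assms(2) by (simp add: field_simps)
  finally show ?case .
qed

text \<open>The finite geometric sum outside the unit circle. It grows like |z|^n, the same factor
  that multiplies the remaining digits when a string is split after n digits.\<close>

lemma ipoly_dpoly_conj_bound':
  fixes z :: complex
  assumes "x \<in> I" "norm z > 1"
  shows "norm (ipoly (dpoly n x) z) \<le> (norm z ^ n - 1) * (\<beta> * norm z / (norm z - 1))"
  using assms(1)
proof (induction n arbitrary: x)
  case 0
  then show ?case by simp
next
  case (Suc n)
  define c where "c = \<beta> * norm z / (norm z - 1)"
  have c: "c * (norm z - 1) = \<beta> * norm z" using assms(2) by (simp add: c_def)
  have d: "norm (of_int (digit x) :: complex) \<le> \<beta>"
    using digit_bounds[OF Suc.prems] by simp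
  have "norm (ipoly (dpoly (Suc n) x) z) = norm z * norm (of_int (digit x) + ipoly (dpoly n (T x)) z)"
    by (simp only: norm_ipoly_dpoly_Suc)
  also have "\<dots> \<le> norm z * (\<beta> + (norm z ^ n - 1) * c)"
    unfolding c_def
    by (intro mult_left_mono order_trans[OF norm_triangle_ineq] add_mono d Suc.IH T_mem_I) simp
  also have "\<dots> = (norm z ^ Suc n - 1) * c"
    using c by (simp add: algebra_simps)
  finally show ?case unfolding c_def .
qed

subsection \<open>Reversed digit strings\<close>

text \<open>
  A point \<open>x \<noteq> 0\<close> with \<open>T\<^sup>n x = 0\<close> is reached from \<open>0\<close> along inverse branches of \<open>T\<close>; the
  value of its reversed digit string follows the expanding recursion \<open>u \<mapsto> - \<beta> u - a\<close>.
  The invariants \<open>P\<close> and \<open>Q\<close> alternate along this path.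
\<close>

lemma reversed_value_invariant:
  assumes start: "\<And>a::int. a \<ge> 1 \<Longrightarrow> - of_int a / \<beta> \<in> I \<Longrightarrow> P (- of_int a / \<beta>) (- of_int a)"
    and PQ: "\<And>y u a::int. y \<in> I \<Longrightarrow> P y u \<Longrightarrow> 0 \<le> a \<Longrightarrow> of_int a \<le> \<beta> \<Longrightarrow> - (y + of_int a) / \<beta> \<in> I
      \<Longrightarrow> Q (- (y + of_int a) / \<beta>) (- \<beta> * u - of_int a)"
    and QP: "\<And>y u a::int. y \<in> I \<Longrightarrow> Q y u \<Longrightarrow> 0 \<le> a \<Longrightarrow> of_int a \<le> \<beta> \<Longrightarrow> - (y + of_int a) / \<beta> \<in> I
      \<Longrightarrow> P (- (y + of_int a) / \<beta>) (- \<beta> * u - of_int a)"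
    and x: "x \<in> I" "(T ^^ n) x = 0" "x \<noteq> 0"
  shows "P x (ipoly (dpoly n x) \<beta> / \<beta>) \<or> Q x (ipoly (dpoly n x) \<beta> / \<beta>)"
  using x
proof (induction n arbitrary: x)
  case 0
  then show ?case by simp
next
  case (Suc n)
  define a where "a = digit x"
  \<comment> \<open>\<open>dpoly\<close> has zero constant term; dividing its value at \<beta> by
    \<beta> gives the recursion u -> -\<beta> u - a.\<close>
  define u where "u = ipoly (dpoly n (T x)) \<beta> / \<beta>"
  have xa: "x = - (T x + of_int a) / \<beta>"
    using \<beta>_gt_1 by (simp add: T_eq a_def)
  have ua: "ipoly (dpoly (Suc n) x) \<beta> / \<beta> = - \<beta> * u - of_int a"
    using \<beta>_gt_1 by (simp add: u_def a_def field_simps)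
  have a: "0 \<le> a" "of_int a \<le> \<beta>"
    using digit_bounds[OF Suc.prems(1)] by (simp_all add: a_def)
  have I: "- (T x + of_int a) / \<beta> \<in> I" using Suc.prems(1) xa by simp
  show ?case
  proof (cases "T x = 0")
    case True
    then have "u = 0" by (simp add: u_def dpoly_0)
    moreover have "a \<noteq> 0" using True xa Suc.prems(3) by auto
    ultimately show ?thesis using start[of a] a I xa ua True by auto
  next
    case False
    have "(T ^^ n) (T x) = 0" using Suc.prems(2) by (simp add: funpow_swap1)
    from Suc.IH[OF T_mem_I this False] show ?thesis
      using PQ[OF T_mem_I _ a I] QP[OF T_mem_I _ a I] unfolding ua u_def[symmetric] xa[symmetric]
      by blast
  qed
qed

text \<open>If T x = y with digit a, then x = -(y + a)/\<beta>; the left endpoint of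
  \<open>I\<close> thus limits which digits may precede y.\<close>

lemma lend_le_inverse_branch:
  assumes "- (y + a) / \<beta> \<in> I"
  shows "y + a \<le> \<beta>\<^sup>2 / (\<beta> + 1)"
proof -
  have "- \<beta> / (\<beta> + 1) \<le> - (y + a) / \<beta>" using assms by (simp add: mem_I)
  then have "\<beta> * (- \<beta> / (\<beta> + 1)) \<le> \<beta> * (- (y + a) / \<beta>)"
    using \<beta>_gt_1 by (intro mult_left_mono) auto
  then show ?thesis using \<beta>_gt_1 by (simp add: power2_eq_square)
qed

text \<open>The recursion u -> -\<beta> u - a expands with alternating signs, and admissibility
  keeps a from cancelling -\<beta> u. How the digits are restricted depends on the size of \<beta>,
  so each range gets its own invariants, \<open>P\<close> forcing u to be negative and
  \<open>Q\<close> forcing it to be positive. The bound is used to exclude conjugates on the unit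
  circle.\<close>

lemma reversed_value_away_from_0:
  "\<exists>\<epsilon>>0. \<forall>n x. x \<in> I \<longrightarrow> (T ^^ n) x = 0 \<longrightarrow> x \<noteq> 0 \<longrightarrow> \<epsilon> \<le> \<bar>ipoly (dpoly n x) \<beta>\<bar>"
proof -
  have mainI: ?thesis
    if "c > 0"
      and start: "\<And>a::int. a \<ge> 1 \<Longrightarrow> - of_int a / \<beta> \<in> I \<Longrightarrow> P (- of_int a / \<beta>) (- of_int a)"
      and PQ: "\<And>y u a::int. y \<in> I \<Longrightarrow> P y u \<Longrightarrow> 0 \<le> a \<Longrightarrow> of_int a \<le> \<beta> \<Longrightarrow> - (y + of_int a) / \<beta> \<in> I
        \<Longrightarrow> Q (- (y + of_int a) / \<beta>) (- \<beta> * u - of_int a)"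
      and QP: "\<And>y u a::int. y \<in> I \<Longrightarrow> Q y u \<Longrightarrow> 0 \<le> a \<Longrightarrow> of_int a \<le> \<beta> \<Longrightarrow> - (y + of_int a) / \<beta> \<in> I
        \<Longrightarrow> P (- (y + of_int a) / \<beta>) (- \<beta> * u - of_int a)"
      and P: "\<And>x u. x \<in> I \<Longrightarrow> P x u \<Longrightarrow> c \<le> \<bar>u\<bar>"
      and Q: "\<And>x u. x \<in> I \<Longrightarrow> Q x u \<Longrightarrow> c \<le> \<bar>u\<bar>"
    for c :: real and P Q :: "real \<Rightarrow> real \<Rightarrow> bool"
  proof (intro exI[of _ c] conjI allI impI)
    fix n x assume x: "x \<in> I" "(T ^^ n) x = 0" "x \<noteq> 0"
    have "c \<le> \<bar>ipoly (dpoly n x) \<beta> / \<beta>\<bar>"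
      using reversed_value_invariant[of P Q, OF start PQ QP x] P Q x(1) by blast
    also have "\<dots> = \<bar>ipoly (dpoly n x) \<beta>\<bar> / \<beta>"
      using \<beta>_gt_1 by simp
    also have "\<dots> \<le> \<bar>ipoly (dpoly n x) \<beta>\<bar>"
      using \<beta>_gt_1 by (simp add: divide_le_eq mult_le_cancel_left1)
    finally show "c \<le> \<bar>ipoly (dpoly n x) \<beta>\<bar>" .
  qed fact
  define q where "q = \<beta>\<^sup>2 / (\<beta> + 1)"
  have q: "q * (\<beta> + 1) = \<beta>\<^sup>2" using \<beta>_gt_1 by (simp add: q_def)
  have branch: "y + of_int a \<le> q" if "- (y + of_int a) / \<beta> \<in> I" for y and a :: int
    using lend_le_inverse_branch[OF that] by (simp add: q_def)
  have branch0: "of_int a \<le> q" if "- of_int a / \<beta> \<in> I" for a :: int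
    using branch[of 0 a] that by simp
  \<comment> \<open>1 + sqrt 2 is the positive root of \<beta>^2 = 2 \<beta> + 1. The sign of the
    cubic decides whether digit 2 can precede the point -1/\<beta>, that is whether 2 - 1/\<beta> <=
    \<open>q\<close>.\<close>
  consider (big) "\<beta> \<ge> 1 + sqrt 2" | (tiny) "\<beta> < 2"
    | (small) "2 \<le> \<beta>" "\<beta>\<^sup>2 < 2 * \<beta> + 1" "\<beta> ^ 3 - 2 * \<beta>\<^sup>2 - \<beta> + 1 < 0"
    | (medium) "2 \<le> \<beta>" "\<beta>\<^sup>2 < 2 * \<beta> + 1" "\<beta> ^ 3 - 2 * \<beta>\<^sup>2 - \<beta> + 1 \<ge> 0"
  proof -
    have "\<beta>\<^sup>2 < 2 * \<beta> + 1" if "\<beta> < 1 + sqrt 2"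
    proof -
      have "(\<beta> - 1)\<^sup>2 < (sqrt 2)\<^sup>2" using that \<beta>_gt_1 by (intro power_strict_mono) auto
      then show ?thesis by (simp add: power2_eq_square algebra_simps)
    qed
    then show thesis using that by linarith
  qed
  then show ?thesis
  proof cases
    case big
    have b2: "\<beta>\<^sup>2 \<ge> 2 * \<beta> + 1"
    proof -
      have "(\<beta> - 1)\<^sup>2 \<ge> (sqrt 2)\<^sup>2" using big by (intro power_mono) auto
      then show ?thesis by (simp add: power2_eq_square algebra_simps)
    qed
    \<comment> \<open>\<open>A\<close> and \<open>B\<close> solve A = \<beta> B - (\<beta> - 1) and
      B = \<beta> A - \<beta> (\<beta> - 1). These are the worst cases of the recursion
      \<open>step\<close>, with (\<beta>^2 - 1) y at its extreme values.\<close>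
    define A where "A = (\<beta>\<^sup>2 + 1) / (\<beta> + 1)"
    define B where "B = 2 * \<beta> / (\<beta> + 1)"
    \<comment> \<open>In the difference u - \<beta> x the digit cancels, so only the position of y
      in \<open>I\<close> matters.\<close>
    have step: "- \<beta> * u - of_int a - \<beta> * (- (y + of_int a) / \<beta>) = - \<beta> * (u - \<beta> * y) - (\<beta>\<^sup>2 - 1) * y"
      for u y and a :: int
      using \<beta>_gt_1 by (simp add: field_simps power2_eq_square)
    have yl: "(\<beta>\<^sup>2 - 1) * y \<ge> - \<beta> * (\<beta> - 1)" and yr: "(\<beta>\<^sup>2 - 1) * y \<le> \<beta> - 1" if "y \<in> I" for y
    proof -
      have "0 \<le> \<beta>\<^sup>2 - 1" using \<beta>_gt_1 by simp
      moreover have "lend \<le> y" "y \<le> rend" using that by (simp_all add: mem_I)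
      ultimately have "(\<beta>\<^sup>2 - 1) * lend \<le> (\<beta>\<^sup>2 - 1) * y" "(\<beta>\<^sup>2 - 1) * y \<le> (\<beta>\<^sup>2 - 1) * rend"
        using mult_left_mono by blast+
      moreover have "(\<beta>\<^sup>2 - 1) = (\<beta> - 1) * (\<beta> + 1)" by (simp add: power2_eq_square algebra_simps)
      ultimately show "(\<beta>\<^sup>2 - 1) * y \<ge> - \<beta> * (\<beta> - 1)" "(\<beta>\<^sup>2 - 1) * y \<le> \<beta> - 1"
        using \<beta>_gt_1 by (simp_all add: mult.commute)
    qed
    show ?thesis
    proof (rule mainI[of "1 / (\<beta> + 1)"
          "\<lambda>x u. (u = \<beta> * x \<and> x \<le> - 1 / \<beta>) \<or> u - \<beta> * x \<le> - B" "\<lambda>x u. A \<le> u - \<beta> * x"])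
      show "0 < 1 / (\<beta> + 1)" using \<beta>_gt_1 by simp
    next
      fix a :: int assume "a \<ge> 1"
      then show "(- of_int a = \<beta> * (- of_int a / \<beta>) \<and> - of_int a / \<beta> \<le> - 1 / \<beta>)
        \<or> - of_int a - \<beta> * (- of_int a / \<beta>) \<le> - B"
        using \<beta>_gt_1 by (simp add: field_simps)
    next
      fix y u :: real and a :: int
      assume y: "y \<in> I" and "(u = \<beta> * y \<and> y \<le> - 1 / \<beta>) \<or> u - \<beta> * y \<le> - B"
      then show "A \<le> - \<beta> * u - of_int a - \<beta> * (- (y + of_int a) / \<beta>)"
        unfolding step
      proof (elim disjE conjE)
        assume "u = \<beta> * y" "y \<le> - 1 / \<beta>"
        \<comment> \<open>The place where \<beta>^2 >= 2 \<beta> + 1 enters: one step from a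
          starting point u = \<beta> y already reaches \<open>A\<close>.\<close>
        have "\<beta> * (\<beta>\<^sup>2 + 1) \<le> (\<beta>\<^sup>2 - 1) * (\<beta> + 1)"
          using b2 by (simp add: algebra_simps power2_eq_square)
        then have "A \<le> (\<beta>\<^sup>2 - 1) * (1 / \<beta>)"
          using \<beta>_gt_1 by (simp add: A_def field_simps)
        also have "\<dots> \<le> (\<beta>\<^sup>2 - 1) * (- y)"
          using \<open>y \<le> - 1 / \<beta>\<close> \<beta>_gt_1 by (intro mult_left_mono) auto
        finally show "A \<le> - \<beta> * (u - \<beta> * y) - (\<beta>\<^sup>2 - 1) * y"
          using \<open>u = \<beta> * y\<close> by simp
      next
        assume "u - \<beta> * y \<le> - B"
        then have "\<beta> * (u - \<beta> * y) \<le> \<beta> * (- B)" using \<beta>_gt_1 by (intro mult_left_mono) auto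
        moreover have "A = \<beta> * B - (\<beta> - 1)"
          using \<beta>_gt_1 by (simp add: A_def B_def divide_simps) (simp add: algebra_simps power2_eq_square)
        ultimately show "A \<le> - \<beta> * (u - \<beta> * y) - (\<beta>\<^sup>2 - 1) * y"
          using yr[OF y] by linarith
      qed
    next
      fix y u :: real and a :: int
      assume y: "y \<in> I" and "A \<le> u - \<beta> * y"
      then have "\<beta> * A \<le> \<beta> * (u - \<beta> * y)" using \<beta>_gt_1 by (intro mult_left_mono) auto
      moreover have "- B = - \<beta> * A + \<beta> * (\<beta> - 1)"
        using \<beta>_gt_1 by (simp add: A_def B_def divide_simps) (simp add: algebra_simps power2_eq_square)
      ultimately show "(- \<beta> * u - of_int a = \<beta> * (- (y + of_int a) / \<beta>) \<and> - (y + of_int a) / \<beta> \<le> - 1 / \<beta>)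
        \<or> - \<beta> * u - of_int a - \<beta> * (- (y + of_int a) / \<beta>) \<le> - B"
        unfolding step using yl[OF y] by linarith
    next
      fix x u :: real assume x: "x \<in> I" and "(u = \<beta> * x \<and> x \<le> - 1 / \<beta>) \<or> u - \<beta> * x \<le> - B"
      moreover have "\<beta> * x < \<beta> * rend" using x \<beta>_gt_1 by (intro mult_strict_left_mono) (auto simp: mem_I)
      moreover have "- B + \<beta> * rend = - \<beta> / (\<beta> + 1)" using \<beta>_gt_1
        by (simp add: B_def divide_simps)
      moreover have "1 / (\<beta> + 1) \<le> \<beta> / (\<beta> + 1)" "1 / (\<beta> + 1) \<le> 1"
        using \<beta>_gt_1 by (simp_all add: divide_right_mono)
      moreover have "\<beta> * x \<le> -1" if "x \<le> - 1 / \<beta>" using that \<beta>_gt_1 by (simp add: field_simps)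
      ultimately show "1 / (\<beta> + 1) \<le> \<bar>u\<bar>" by auto
    next
      fix x u :: real assume x: "x \<in> I" and "A \<le> u - \<beta> * x"
      moreover have "\<beta> * x \<ge> \<beta> * lend" using x \<beta>_gt_1 by (intro mult_left_mono) (auto simp: mem_I)
      moreover have "A + \<beta> * lend = 1 / (\<beta> + 1)" using \<beta>_gt_1
        by (simp add: A_def divide_simps power2_eq_square)
      ultimately show "1 / (\<beta> + 1) \<le> \<bar>u\<bar>" by linarith
    qed
  next
    case tiny
    \<comment> \<open>Digits are at most 1. The inequality \<beta>^2 >= \<beta> + 1 says that digit
      1 may precede 0; otherwise no nonzero point of \<open>I\<close> reaches 0 and both invariants
      are \<open>False\<close>.\<close>
    show ?thesis
    proof (cases "\<beta>\<^sup>2 \<ge> \<beta> + 1")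
      case True
      show ?thesis
      proof (rule mainI[of "\<beta> - 1" "\<lambda>x u. u \<le> - 1" "\<lambda>x u. \<beta> - 1 \<le> u"])
        fix y u :: real and a :: int assume "u \<le> - 1" "of_int a \<le> \<beta>"
        then have "a \<le> 1" using tiny by linarith
        moreover have "\<beta> * u \<le> \<beta> * (- 1)" using \<open>u \<le> - 1\<close> \<beta>_gt_1 by (intro mult_left_mono) auto
        ultimately show "\<beta> - 1 \<le> - \<beta> * u - of_int a" by simp
      next
        fix y u :: real and a :: int assume "\<beta> - 1 \<le> u" "0 \<le> a"
        moreover have "\<beta> * (\<beta> - 1) \<le> \<beta> * u" using \<open>\<beta> - 1 \<le> u\<close> \<beta>_gt_1 by (intro mult_left_mono) auto
        ultimately show "- \<beta> * u - of_int a \<le> - 1" using True by (simp add: algebra_simps power2_eq_square)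
      qed (use \<beta>_gt_1 tiny in auto)
    next
      case False
      show ?thesis
      proof (rule mainI[of 1 "\<lambda>x u. False" "\<lambda>x u. False"])
        fix a :: int assume "a \<ge> 1" "- of_int a / \<beta> \<in> I"
        then have "1 \<le> q" using branch0[of a] by linarith
        then have "\<beta> + 1 \<le> q * (\<beta> + 1)" using \<beta>_gt_1 by simp
        then show False using False q by simp
      qed auto
    qed
  next
    case small
    have q2: "q < 2"
    proof (rule ccontr)
      assume "\<not> q < 2"
      then have "2 * (\<beta> + 1) \<le> q * (\<beta> + 1)" using \<beta>_gt_1 by (intro mult_right_mono) auto
      then show False using q small by simp
    qed
    \<comment> \<open>Digit 1 is the only nonzero digit that can precede 0, and digit 2 cannot
      precede -1/\<beta>. Once these first steps are made, |u| is so large that even digit 2 does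
      not cancel it.\<close>
    show ?thesis
    proof (rule mainI[of 1 "\<lambda>x u. (u = - 1 \<and> x = - 1 / \<beta>) \<or> u \<le> - \<beta> * (\<beta> - 1)" "\<lambda>x u. \<beta> - 1 \<le> u"])
      fix a :: int assume "a \<ge> 1" "- of_int a / \<beta> \<in> I"
      then have "a = 1" using branch0[of a] q2 by linarith
      then show "(- of_int a = - (1::real) \<and> - of_int a / \<beta> = - 1 / \<beta>) \<or> - of_int a \<le> - \<beta> * (\<beta> - 1)" by simp
    next
      fix y u :: real and a :: int
      assume "(u = - 1 \<and> y = - 1 / \<beta>) \<or> u \<le> - \<beta> * (\<beta> - 1)" "of_int a \<le> \<beta>"
        and a: "- (y + of_int a) / \<beta> \<in> I"
      then show "\<beta> - 1 \<le> - \<beta> * u - of_int a"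
      proof (elim disjE conjE)
        assume u: "u = - 1" "y = - 1 / \<beta>"
        have "a < 2"
        proof (rule ccontr)
          assume "\<not> a < 2"
          then have "2 - 1 / \<beta> \<le> q" using branch[OF a] u by simp
          then have "(2 - 1 / \<beta>) * (\<beta> * (\<beta> + 1)) \<le> q * (\<beta> * (\<beta> + 1))"
            using \<beta>_gt_1 by (intro mult_right_mono) auto
          also have "\<dots> = \<beta> ^ 3" using q by (simp add: power2_eq_square power3_eq_cube mult.left_commute)
          also have "(2 - 1 / \<beta>) * (\<beta> * (\<beta> + 1)) = 2 * \<beta>\<^sup>2 + \<beta> - 1"
            using \<beta>_gt_1 by (simp add: field_simps power2_eq_square)
          finally show False using small by simp
        qed
        then show ?thesis using u by simp
      next
        assume "u \<le> - \<beta> * (\<beta> - 1)"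
        then have "\<beta> * u \<le> \<beta> * (- \<beta> * (\<beta> - 1))" using \<beta>_gt_1 by (intro mult_left_mono) auto
        moreover have "2 \<le> (\<beta>\<^sup>2 - 1) * (\<beta> - 1)"
        proof -
          have "2\<^sup>2 \<le> \<beta>\<^sup>2" using small by (intro power_mono) auto
          then have "(2::real) * 1 \<le> (\<beta>\<^sup>2 - 1) * (\<beta> - 1)" using small by (intro mult_mono) auto
          then show ?thesis by simp
        qed
        moreover have "of_int a \<le> (2::real)"
        proof -
          have "\<beta> < 3"
          proof (rule ccontr)
            assume "\<not> \<beta> < 3"
            then have "3 * \<beta> \<le> \<beta> * \<beta>" by (intro mult_right_mono) auto
            then show False using small \<open>\<not> \<beta> < 3\<close> unfolding power2_eq_square by linarith
          qed
          then have "a < 3" using \<open>of_int a \<le> \<beta>\<close> by linarith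
          then show ?thesis by simp
        qed
        ultimately show ?thesis by (simp add: algebra_simps power2_eq_square)
      qed
    next
      fix y u :: real and a :: int assume "\<beta> - 1 \<le> u" "0 \<le> a"
      moreover have "\<beta> * (\<beta> - 1) \<le> \<beta> * u" using \<open>\<beta> - 1 \<le> u\<close> \<beta>_gt_1 by (intro mult_left_mono) auto
      ultimately show "(- \<beta> * u - of_int a = - 1 \<and> - (y + of_int a) / \<beta> = - 1 / \<beta>)
         \<or> - \<beta> * u - of_int a \<le> - \<beta> * (\<beta> - 1)" by simp
    next
      fix x u :: real assume "(u = - 1 \<and> x = - 1 / \<beta>) \<or> u \<le> - \<beta> * (\<beta> - 1)"
      moreover have "1 * 1 \<le> \<beta> * (\<beta> - 1)" using small by (intro mult_mono) auto
      ultimately show "1 \<le> \<bar>u\<bar>" by auto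
    qed (use small in auto)
  next
    case medium
    have b3: "\<beta> < 3"
    proof (rule ccontr)
      assume "\<not> \<beta> < 3"
      then have "3 * \<beta> \<le> \<beta> * \<beta>" by (intro mult_right_mono) auto
      then show False using medium \<open>\<not> \<beta> < 3\<close> unfolding power2_eq_square by linarith
    qed
    have "\<beta> \<noteq> 2" using medium(3) by auto
    then have b2: "\<beta> > 2" using medium by simp
    have bb: "\<beta> * (\<beta> - 2) \<le> 1" using medium by (simp add: algebra_simps power2_eq_square)
    \<comment> \<open>Digit 2 may precede y only if y <= q - 2, so \<open>P\<close> demands the
      stronger bound u <= -1 there. For digits at most 1 the weaker bound is enough, by the cubic
      inequality.\<close>
    show ?thesis
    proof (rule mainI[of "\<beta> - 2" "\<lambda>x u. u \<le> - \<beta> * (\<beta> - 2) \<and> (x \<le> q - 2 \<longrightarrow> u \<le> - 1)" "\<lambda>x u. \<beta> - 2 \<le> u"])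
      fix a :: int assume "a \<ge> 1"
      then show "- of_int a \<le> - \<beta> * (\<beta> - 2) \<and> (- of_int a / \<beta> \<le> q - 2 \<longrightarrow> - of_int a \<le> - (1::real))"
        using bb by auto
    next
      fix y u :: real and a :: int
      assume u: "u \<le> - \<beta> * (\<beta> - 2) \<and> (y \<le> q - 2 \<longrightarrow> u \<le> - 1)" and a: "of_int a \<le> \<beta>"
        and I: "- (y + of_int a) / \<beta> \<in> I"
      have "a \<le> 2" using a b3 by linarith
      show "\<beta> - 2 \<le> - \<beta> * u - of_int a"
      proof (cases "a = 2")
        case True
        then have "u \<le> - 1" using branch[OF I] u by auto
        then have "\<beta> * u \<le> \<beta> * (- 1)" using \<beta>_gt_1 by (intro mult_left_mono) auto
        then show ?thesis using True by simp
      next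
        case False
        then have "of_int a \<le> (1::real)" using \<open>a \<le> 2\<close> by simp
        moreover have "\<beta> * u \<le> \<beta> * (- \<beta> * (\<beta> - 2))" using u \<beta>_gt_1 by (intro mult_left_mono) auto
        ultimately show ?thesis using medium(3)
          by (simp add: algebra_simps power2_eq_square power3_eq_cube)
      qed
    next
      fix y u :: real and a :: int
      assume y: "y \<in> I" and u: "\<beta> - 2 \<le> u" and a: "0 \<le> a"
      have bu: "\<beta> * (\<beta> - 2) \<le> \<beta> * u" using u \<beta>_gt_1 by (intro mult_left_mono) auto
      have "- \<beta> * u - of_int a \<le> - 1" if x: "- (y + of_int a) / \<beta> \<le> q - 2"
      proof (cases "a = 0")
        case True
        \<comment> \<open>Digit 0 cannot lead to a point that is at most q - 2: the chain ends in
          the absurd -1 <= -\<beta>.\<close>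
        have "\<beta> * (- y / \<beta>) \<le> \<beta> * (q - 2)" using x True \<beta>_gt_1 by (intro mult_left_mono) auto
        then have "- rend \<le> \<beta> * (q - 2)" using y \<beta>_gt_1 by (simp add: mem_I)
        then have "- rend * (\<beta> + 1) \<le> \<beta> * (q - 2) * (\<beta> + 1)" using \<beta>_gt_1 by (intro mult_right_mono) auto
        then have "- 1 \<le> \<beta> * (q * (\<beta> + 1) - 2 * (\<beta> + 1))" using \<beta>_gt_1 by (simp add: algebra_simps)
        then have "- 1 \<le> \<beta> * (\<beta>\<^sup>2 - 2 * \<beta> - 2)" unfolding q by (simp add: algebra_simps)
        also have "\<dots> \<le> \<beta> * (- 1)" using medium \<beta>_gt_1 by (intro mult_left_mono) auto
        finally show ?thesis using \<beta>_gt_1 by simp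
      next
        case False
        then have "(1::real) \<le> of_int a" using a by simp
        moreover have "0 \<le> \<beta> * (\<beta> - 2)" using b2 by simp
        ultimately show ?thesis using bu by linarith
      qed
      then show "- \<beta> * u - of_int a \<le> - \<beta> * (\<beta> - 2)
          \<and> (- (y + of_int a) / \<beta> \<le> q - 2 \<longrightarrow> - \<beta> * u - of_int a \<le> - 1)"
        using bu a by simp
    next
      fix x u :: real assume "u \<le> - \<beta> * (\<beta> - 2) \<and> (x \<le> q - 2 \<longrightarrow> u \<le> - 1)"
      moreover have "1 * (\<beta> - 2) \<le> \<beta> * (\<beta> - 2)" using b2 by (intro mult_right_mono) auto
      ultimately have "\<beta> - 2 \<le> - u" by simp
      then show "\<beta> - 2 \<le> \<bar>u\<bar>" by linarith
    qed (use b2 in auto)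
  qed
qed

subsection \<open>Periodic orbits and preimages of zero\<close>

lemma lend_mem_I: "lend \<in> I"
  unfolding mem_I using lend_lt_0 rend_gt_0 by linarith

lemma d_neg_funpow: "d_neg \<beta> ((T ^^ m) x) i = d_neg \<beta> x (m + i)"
  by (simp add: d_neg_eq funpow_add add.commute)

text \<open>Equal digits make the difference of the two orbits grow like \<beta>^n, while
  \<open>I\<close> has length 1.\<close>

lemma d_neg_inj:
  assumes "x \<in> I" "y \<in> I" "d_neg \<beta> x = d_neg \<beta> y"
  shows "x = y"
proof (rule ccontr)
  assume "x \<noteq> y"
  have *: "(T ^^ n) x - (T ^^ n) y = (- \<beta>) ^ n * (x - y)" for n
  proof (induction n)
    case (Suc n)
    have "digit ((T ^^ n) x) = digit ((T ^^ n) y)"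
      using fun_cong[OF assms(3), of n] by (simp add: d_neg_eq)
    then have "(T ^^ Suc n) x - (T ^^ Suc n) y = - \<beta> * ((T ^^ n) x - (T ^^ n) y)"
      by (simp add: T_eq algebra_simps)
    then show ?case using Suc by simp
  qed simp
  have "\<beta> ^ n * \<bar>x - y\<bar> < 1" for n
  proof -
    have "\<bar>(T ^^ n) x - (T ^^ n) y\<bar> < 1"
      using funpow_T_mem_I[OF assms(1), of n] funpow_T_mem_I[OF assms(2), of n] rend_eq
      unfolding mem_I by linarith
    then show ?thesis unfolding * using \<beta>_gt_1 by (simp add: abs_mult power_abs)
  qed
  moreover obtain n where "1 / \<bar>x - y\<bar> < \<beta> ^ n"
    using real_arch_pow[OF \<beta>_gt_1] by blast
  ultimately show False using \<open>x \<noteq> y\<close> by (simp add: field_simps) (meson less_asym)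
qed

text \<open>By injectivity of the expansion, a repetition among the tails of the digit string is a
  repetition in the orbit.\<close>

lemma finite_orbit_of_eventually_periodic:
  assumes "x \<in> I" "eventually_periodic (d_neg \<beta> x)"
  shows "finite (range (\<lambda>n. (T ^^ n) x))"
proof -
  obtain v w where w: "w \<noteq> []" and d: "d_neg \<beta> x = v \<frown> w\<^sup>\<omega>"
    using assms(2) by (auto simp: eventually_periodic_def)
  define m p where "m = length v" and "p = length w"
  have p: "p > 0" using w by (simp add: p_def)
  have "d_neg \<beta> x (m + p + i) = d_neg \<beta> x (m + i)" for i
    using w unfolding d by (simp add: m_def p_def conc_def add.assoc)
  then have "d_neg \<beta> ((T ^^ (m + p)) x) = d_neg \<beta> ((T ^^ m) x)"
    by (intro ext) (simp add: d_neg_funpow)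
  then have per: "(T ^^ (m + p)) x = (T ^^ m) x"
    by (intro d_neg_inj funpow_T_mem_I assms(1))
  have "(T ^^ n) x \<in> (\<lambda>n. (T ^^ n) x) ` {..<m + p}" for n
  proof (induction n rule: less_induct)
    case (less n)
    show ?case
    proof (cases "n < m + p")
      case False
      then have "(T ^^ n) x = (T ^^ (n - (m + p))) ((T ^^ (m + p)) x)"
        by (metis funpow_add le_add_diff_inverse2 not_less o_apply)
      also have "\<dots> = (T ^^ (n - (m + p) + m)) x"
        unfolding per by (simp add: funpow_add)
      also have "n - (m + p) + m = n - p" using False by simp
      finally show ?thesis using less[of "n - p"] False p by simp
    qed auto
  qed
  then have "range (\<lambda>n. (T ^^ n) x) \<subseteq> (\<lambda>n. (T ^^ n) x) ` {..<m + p}" by blast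
  then show ?thesis by (rule finite_subset) simp
qed

lemma ends_in_zerosI:
  assumes "(T ^^ n) x = 0"
  shows "ends_in_zeros (d_neg \<beta> x)"
proof -
  have "d_neg \<beta> x = map (d_neg \<beta> x) [0..<n] \<frown> [0]\<^sup>\<omega>"
  proof
    fix i
    show "d_neg \<beta> x i = (map (d_neg \<beta> x) [0..<n] \<frown> [0]\<^sup>\<omega>) i"
    proof (cases "i < n")
      case False
      then have "(T ^^ i) x = 0" using funpow_T_zero_mono[OF assms] by simp
      then show ?thesis using False by (simp add: conc_def d_neg_eq digit_zero)
    qed (simp add: conc_def)
  qed
  then show ?thesis unfolding ends_in_zeros_def by blast
qed

lemma purely_periodicI:
  assumes "(T ^^ n) x = x" "n > 0"
  shows "purely_periodic (d_neg \<beta> x)"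
proof -
  have "d_neg \<beta> x = (map (d_neg \<beta> x) [0..<n])\<^sup>\<omega>"
  proof
    fix i
    have "(T ^^ i) x = (T ^^ (i mod n)) x"
      using funpow_mod_eq[OF assms(1), of i] by simp
    then show "d_neg \<beta> x i = (map (d_neg \<beta> x) [0..<n])\<^sup>\<omega> i"
      using assms(2) by (simp add: d_neg_eq)
  qed
  then show ?thesis unfolding purely_periodic_def using assms(2)
    by (intro exI[of _ "map (d_neg \<beta> x) [0..<n]"]) simp
qed

text \<open>
  A preimage of \<open>0\<close> of order \<open>j\<close> keeps distance of order \<open>\<beta>\<^sup>-\<^sup>j\<close> from both endpoints of \<open>I\<close>: two
  points that are closer follow the orbit of the left endpoint together, because a point slightly
  to the left of that endpoint reappears to the left of the right endpoint, which \<open>T\<close> sends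
  back to the right of the left endpoint.
\<close>

lemma preimages_of_0_away_from_ends:
  assumes "finite (range (\<lambda>n. (T ^^ n) lend))" "\<And>n. (T ^^ n) lend \<noteq> 0"
  shows "\<exists>g>0. \<forall>j u. u \<in> I \<longrightarrow> (T ^^ j) u = 0 \<longrightarrow> g / \<beta> ^ j \<le> u - lend \<and> g / \<beta> ^ j \<le> rend - u"
proof -
  define Orb where "Orb = range (\<lambda>n. (T ^^ n) lend)"
  have OrbI: "o' \<in> I" if "o' \<in> Orb" for o'
    using that funpow_T_mem_I[OF lend_mem_I] by (auto simp: Orb_def)
  have T_Orb: "T o' \<in> Orb" if o': "o' \<in> Orb" for o'
  proof -
    obtain n where n: "o' = (T ^^ n) lend" using o' unfolding Orb_def by (rule rangeE)
    show ?thesis unfolding Orb_def by (rule range_eqI[of _ _ "Suc n"]) (simp add: n)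
  qed
  have lend_Orb: "lend \<in> Orb" unfolding Orb_def by (rule range_eqI[of _ _ 0]) simp
  \<comment> \<open>The distances that must not be beaten: of 0 from the right endpoint, and of
    orbit points from 0, from the right endpoint, and from the left one unless they equal it. The
    element 1 is the length of \<open>I\<close>.\<close>
  define S where "S = {rend, 1} \<union> abs ` Orb \<union> (\<lambda>o'. rend - o') ` Orb \<union> (\<lambda>o'. o' - lend) ` (Orb - {lend})"
  define g where "g = Min S"
  have "finite S" using assms(1) by (simp add: S_def Orb_def)
  have "S \<noteq> {}" by (simp add: S_def)
  have gle: "g \<le> s" if "s \<in> S" for s
    using \<open>finite S\<close> that by (simp add: g_def)
  have "0 \<notin> Orb"
  proof
    assume "0 \<in> Orb"
    then obtain n where "0 = (T ^^ n) lend" unfolding Orb_def by (rule rangeE)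
    then show False using assms(2)[of n] by metis
  qed
  have "s > 0" if "s \<in> S" for s
  proof -
    consider "s = rend" | "s = 1" | o' where "o' \<in> Orb" "s = \<bar>o'\<bar>" | o' where "o' \<in> Orb" "s = rend - o'"
      | o' where "o' \<in> Orb" "o' \<noteq> lend" "s = o' - lend"
      using \<open>s \<in> S\<close> unfolding S_def by blast
    then show ?thesis
    proof cases
      case 3
      then show ?thesis using \<open>0 \<notin> Orb\<close> by auto
    next
      case 4
      then show ?thesis using OrbI by (simp add: mem_I)
    next
      case 5
      then have "lend \<le> o'" using OrbI mem_I by blast
      then show ?thesis using 5 by linarith
    qed (use rend_gt_0 in auto)
  qed
  then have "g > 0" using Min_in[OF \<open>finite S\<close> \<open>S \<noteq> {}\<close>] by (simp add: g_def)
  \<comment> \<open>\<open>T\<close> moves points near \<open>lend\<close> to points near later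
    orbit points, so the induction has to cover all of \<open>Orb\<close>, and \<open>rend\<close>
    as well because of the wrap-around.\<close>
  have key: "g / \<beta> ^ j \<le> \<bar>u - o'\<bar>" if "u \<in> I" "(T ^^ j) u = 0" "o' \<in> insert rend Orb" for j u o'
    using that
  proof (induction j arbitrary: u o')
    case 0
    then show ?case using gle rend_gt_0 by (auto simp: S_def)
  next
    case (Suc j)
    have Tu: "(T ^^ j) (T u) = 0" using Suc.prems(2) by (simp add: funpow_swap1)
    have bj: "g / \<beta> ^ j \<le> g" using \<open>g > 0\<close> \<beta>_gt_1 by (simp add: divide_le_eq mult_le_cancel_left1)
    show ?case
    proof (rule ccontr)
      assume "\<not> ?thesis"
      then have "\<beta> * \<bar>u - o'\<bar> < \<beta> * (g / \<beta> ^ Suc j)"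
        using \<beta>_gt_1 by (intro mult_strict_left_mono) auto
      then have close: "\<beta> * \<bar>u - o'\<bar> < g / \<beta> ^ j" using \<beta>_gt_1 by simp
      have abs\<beta>: "\<bar>\<beta> * t\<bar> = \<beta> * \<bar>t\<bar>" for t using \<beta>_gt_1 by (simp add: abs_mult)
      show False
      proof (cases "o' = rend")
        case True
        have "u < rend" using Suc.prems(1) by (simp add: mem_I)
        have "lend = - \<beta> * rend" by simp
        then have eq: "lend + \<beta> * \<bar>u - o'\<bar> = - \<beta> * u - of_int 0"
          using True \<open>u < rend\<close> by (simp add: algebra_simps)
        have "lend + \<beta> * \<bar>u - o'\<bar> \<in> I"
          using close bj gle[of 1] \<beta>_gt_1 rend_eq unfolding mem_I by (simp add: S_def)
        then have "T u = lend + \<beta> * \<bar>u - o'\<bar>" using T_eqI eq by blast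
        then have "\<bar>T u - lend\<bar> < g / \<beta> ^ j" using close \<beta>_gt_1 by simp
        then show False using Suc.IH[OF T_mem_I Tu, of lend] lend_Orb by simp
      next
        case False
        then have o': "o' \<in> Orb" using Suc.prems(3) by simp
        \<comment> \<open>The image of u under the branch of \<open>T\<close> that belongs to o'. It
          equals T u unless it falls to the left of \<open>lend\<close>; then the digit of u is one
          smaller.\<close>
        define v where "v = T o' - \<beta> * (u - o')"
        have v: "v = - \<beta> * u - of_int (digit o')" by (simp add: v_def T_eq algebra_simps)
        have vclose: "\<bar>v - T o'\<bar> < g / \<beta> ^ j" using close by (simp add: v_def abs\<beta>)
        have "v < rend" using vclose bj gle[of "rend - T o'"] T_Orb[OF o'] by (auto simp: S_def)
        show False
        proof (cases "v \<in> I")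
          case True
          then have "T u = v" using T_eqI v by blast
          then show False using Suc.IH[OF T_mem_I Tu, of "T o'"] T_Orb[OF o'] vclose by simp
        next
          case False
          then have "v < lend" using \<open>v < rend\<close> by (simp add: mem_I)
          have "T o' = lend"
          proof (rule ccontr)
            assume "T o' \<noteq> lend"
            then have "g \<le> T o' - lend" using gle[of "T o' - lend"] T_Orb[OF o'] by (simp add: S_def)
            then show False using vclose bj \<open>v < lend\<close> by linarith
          qed
          then have "v + 1 \<in> I" using vclose bj gle[of 1] \<open>v < lend\<close> rend_eq
            unfolding mem_I by (simp add: S_def)
          moreover have "v + 1 = - \<beta> * u - of_int (digit o' - 1)" using v by simp
          ultimately have "T u = v + 1" using T_eqI by blast
          then have "\<bar>T u - rend\<bar> < g / \<beta> ^ j"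
            using vclose \<open>T o' = lend\<close> rend_eq by simp
          then show False using Suc.IH[OF T_mem_I Tu, of rend] by simp
        qed
      qed
    qed
  qed
  show ?thesis
  proof (intro exI[of _ g] conjI allI impI)
    fix j u assume u: "u \<in> I" "(T ^^ j) u = 0"
    show "g / \<beta> ^ j \<le> u - lend" using key[OF u, of lend] lend_Orb u(1) by (simp add: mem_I)
    show "g / \<beta> ^ j \<le> rend - u" using key[OF u, of rend] u(1) by (simp add: mem_I)
  qed fact
qed

text \<open>After i steps the perturbation x (-1/\<beta>)^N of w has grown to x (-1/\<beta>)^(N -
  i), still less than the distance of the i-th iterate of w from both endpoints. So x and w share
  their first N digits, and the N-th iterate of x is 0 + x.\<close>

lemma fixed_point_of_perturbed_preimage:
  assumes g: "\<And>j u. u \<in> I \<Longrightarrow> (T ^^ j) u = 0 \<Longrightarrow> g / \<beta> ^ j \<le> u - lend \<and> g / \<beta> ^ j \<le> rend - u"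
    and x: "\<bar>x\<bar> < g" and w: "x - x * (- 1 / \<beta>) ^ N \<in> I" "(T ^^ N) (x - x * (- 1 / \<beta>) ^ N) = 0"
  shows "(T ^^ N) x = x"
proof -
  define w where "w = x - x * (- 1 / \<beta>) ^ N"
  have "(T ^^ i) x = (T ^^ i) w + x * (- 1 / \<beta>) ^ (N - i)" if "i \<le> N" for i
    using that
  proof (induction i)
    case (Suc i)
    define y where "y = (T ^^ Suc i) w + x * (- 1 / \<beta>) ^ (N - Suc i)"
    have "(T ^^ (N - Suc i)) ((T ^^ Suc i) w) = 0"
      using w(2) Suc.prems unfolding w_def[symmetric]
      by (metis funpow_add le_add_diff_inverse2 o_apply)
    then have "g / \<beta> ^ (N - Suc i) \<le> (T ^^ Suc i) w - lend" "g / \<beta> ^ (N - Suc i) \<le> rend - (T ^^ Suc i) w"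
      using g funpow_T_mem_I[OF w(1)[folded w_def]] by blast+
    moreover have "\<bar>x * (- 1 / \<beta>) ^ (N - Suc i)\<bar> < g / \<beta> ^ (N - Suc i)"
    proof -
      have "\<bar>x * (- 1 / \<beta>) ^ (N - Suc i)\<bar> = \<bar>x\<bar> / \<beta> ^ (N - Suc i)"
        using \<beta>_gt_1 by (simp add: abs_mult power_abs power_divide)
      also have "\<dots> < g / \<beta> ^ (N - Suc i)"
        using x \<beta>_gt_1 by (intro divide_strict_right_mono) auto
      finally show ?thesis .
    qed
    ultimately have "y \<in> I" unfolding y_def mem_I by linarith
    moreover have "y = - \<beta> * (T ^^ i) x - of_int (digit ((T ^^ i) w))"
    proof -
      have "(- 1 / \<beta>) ^ (N - i) = (- 1 / \<beta>) * (- 1 / \<beta>) ^ (N - Suc i)"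
        using Suc.prems by (metis Suc_diff_Suc Suc_le_lessD power_Suc)
      then have "(T ^^ i) x = (T ^^ i) w - x * (- 1 / \<beta>) ^ (N - Suc i) / \<beta>"
        using Suc by simp
      also have "- \<beta> * \<dots> = - \<beta> * (T ^^ i) w + x * (- 1 / \<beta>) ^ (N - Suc i)"
        using \<beta>_gt_1 by (simp add: right_diff_distrib)
      finally have "- \<beta> * (T ^^ i) x = - \<beta> * (T ^^ i) w + x * (- 1 / \<beta>) ^ (N - Suc i)" .
      then show ?thesis by (simp add: y_def T_eq)
    qed
    ultimately have "T ((T ^^ i) x) = y" by (rule T_eqI)
    then show ?case by (simp add: y_def)
  qed (simp add: w_def)
  from this[of N] show ?thesis using w(2) by (simp add: w_def)
qed

end

subsection \<open>Conjugates of algebraic numbers\<close>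

text \<open>A one-way transfer of integer relations; for algebraic a it is the usual conjugacy,
  symmetric by \<open>is_conj_sym\<close>.\<close>

definition is_conj :: "complex \<Rightarrow> complex \<Rightarrow> bool" where
  "is_conj a b \<longleftrightarrow> (\<forall>p. ipoly p a = 0 \<longrightarrow> ipoly p b = 0)"

text \<open>Only the degree is minimal, with no normalisation of the leading coefficient; hence the
  factor \<open>k\<close> in \<open>min_poly_dvd\<close>.\<close>

definition is_min_poly :: "complex \<Rightarrow> int poly \<Rightarrow> bool" where
  "is_min_poly a p \<longleftrightarrow> p \<noteq> 0 \<and> ipoly p a = 0 \<and> (\<forall>q. q \<noteq> 0 \<longrightarrow> ipoly q a = 0 \<longrightarrow> degree p \<le> degree q)"

lemma min_poly_exists:
  assumes "q \<noteq> 0" "ipoly q a = 0"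
  shows "\<exists>p. is_min_poly a p"
  using ex_has_least_nat[of "\<lambda>q. q \<noteq> 0 \<and> ipoly q a = 0" q degree] assms
  unfolding is_min_poly_def by blast

text \<open>Pseudo-division stays within integer polynomials; its remainder vanishes at a and has
  smaller degree, so it is zero.\<close>

lemma min_poly_dvd:
  assumes p: "is_min_poly a p" and q: "ipoly q a = 0"
  shows "\<exists>k s. k \<noteq> 0 \<and> smult k q = p * s"
proof -
  obtain s r where sr: "pseudo_divmod q p = (s, r)" by fastforce
  define k where "k = coeff p (degree p) ^ (Suc (degree q) - degree p)"
  have p0: "p \<noteq> 0" using p by (simp add: is_min_poly_def)
  have eq: "smult k q = p * s + r" and deg: "r = 0 \<or> degree r < degree p"
    using pseudo_divmod[OF p0 sr] by (simp_all add: k_def)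
  have "ipoly (smult k q) a = ipoly (p * s + r) a" by (simp only: eq)
  then have "ipoly r a = 0" using p q by (simp add: is_min_poly_def)
  then have "r = 0" using p deg unfolding is_min_poly_def by (metis not_less)
  moreover have "k \<noteq> 0" using p0 by (simp add: k_def)
  ultimately show ?thesis using eq by auto
qed

lemma min_poly_roots:
  assumes "is_min_poly a p"
  shows "ipoly p z = 0 \<longleftrightarrow> is_conj a z"
proof
  assume z: "ipoly p z = 0"
  show "is_conj a z"
    unfolding is_conj_def
  proof (intro allI impI)
    fix q assume "ipoly q a = 0"
    then obtain k s where "k \<noteq> 0" "smult k q = p * s" using min_poly_dvd[OF assms] by blast
    then have "ipoly (smult k q) z = ipoly (p * s) z" by simp
    then show "ipoly q z = 0" using z \<open>k \<noteq> 0\<close> by simp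
  qed
qed (use assms in \<open>auto simp: is_conj_def is_min_poly_def\<close>)

text \<open>The minimal polynomial g of b divides a multiple of the minimal polynomial p of a. If g
  did not vanish at a, the cofactor would, and then minimality of p would make g constant.\<close>

lemma is_conj_sym:
  assumes "q \<noteq> 0" "ipoly q a = 0" "is_conj a b"
  shows "is_conj b a"
proof -
  obtain p where p: "is_min_poly a p" using min_poly_exists assms by blast
  then have "p \<noteq> 0" "ipoly p b = 0" using assms(3) by (auto simp: is_min_poly_def is_conj_def)
  then obtain g where g: "is_min_poly b g" using min_poly_exists by blast
  obtain k s where k: "k \<noteq> 0" and eq: "smult k p = g * s"
    using min_poly_dvd[OF g \<open>ipoly p b = 0\<close>] by blast
  have g0: "g \<noteq> 0" and s0: "s \<noteq> 0" using eq k \<open>p \<noteq> 0\<close> by auto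
  have "ipoly g a = 0"
  proof (rule ccontr)
    assume "ipoly g a \<noteq> 0"
    moreover have "ipoly (smult k p) a = ipoly g a * ipoly s a" by (simp only: eq ipoly_mult)
    ultimately have "ipoly s a = 0" using p by (simp add: is_min_poly_def)
    then have "degree p \<le> degree s" using p s0 by (simp add: is_min_poly_def)
    moreover have "degree p = degree g + degree s"
      using arg_cong[OF eq, of degree] k g0 s0 by (simp add: degree_mult_eq)
    ultimately have "degree g = 0" by simp
    then obtain c where "g = [:c:]" by (meson degree_eq_zeroE)
    then show False using g by (simp add: is_min_poly_def)
  qed
  then show ?thesis using min_poly_roots[OF g] by simp
qed

lemma map_poly_of_int_pderiv: "pderiv (map_poly of_int p) = map_poly (of_int :: int \<Rightarrow> complex) (pderiv p)"
  by (rule poly_eqI) (simp add: coeff_pderiv coeff_map_poly)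

text \<open>A minimal polynomial has simple roots: at a double root z the derivative vanishes, hence
  by symmetry also at a, against minimality of the degree.\<close>

lemma card_conjugates:
  assumes p: "is_min_poly a p"
  shows "finite {z. is_conj a z}" "card {z. is_conj a z} = degree p"
proof -
  let ?p = "map_poly of_int p :: complex poly"
  have p0: "?p \<noteq> 0" using p by (auto simp: is_min_poly_def map_poly_eq_0_iff)
  have roots: "{z. is_conj a z} = {z. poly ?p z = 0}" using min_poly_roots[OF p] by simp
  show "finite {z. is_conj a z}" unfolding roots using p0 by (rule poly_roots_finite)
  have "rsquarefree ?p"
    unfolding rsquarefree_roots
  proof (intro allI notI, elim conjE)
    fix z assume z: "ipoly p z = 0" "poly (pderiv ?p) z = 0"
    have dp: "degree p \<noteq> 0"
    proof
      assume "degree p = 0"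
      then obtain c where "p = [:c:]" by (meson degree_eq_zeroE)
      then show False using p by (simp add: is_min_poly_def)
    qed
    have "is_conj a z" using z min_poly_roots[OF p] by simp
    then have "is_conj z a" using is_conj_sym p by (auto simp: is_min_poly_def)
    moreover have "ipoly (pderiv p) z = 0" using z by (simp add: map_poly_of_int_pderiv)
    ultimately have "ipoly (pderiv p) a = 0" by (simp add: is_conj_def)
    moreover have "pderiv p \<noteq> 0" using dp by (simp add: pderiv_eq_0_iff)
    ultimately have "degree p \<le> degree (pderiv p)" using p by (simp add: is_min_poly_def)
    then show False using dp by (simp add: degree_pderiv)
  qed
  then have "smult (lead_coeff ?p) (\<Prod>z|poly ?p z = 0. [:-z, 1:]) = ?p"
    by (rule complex_poly_decompose_rsquarefree)
  then have "degree ?p = degree (\<Prod>z|poly ?p z = 0. [:-z, 1:])"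
    using p0 by (metis degree_smult_eq leading_coeff_0_iff)
  also have "\<dots> = card {z. poly ?p z = 0}"
    by (subst degree_prod_eq_sum_degree) auto
  finally show "card {z. is_conj a z} = degree p"
    unfolding roots by (simp add: degree_map_poly)
qed

section \<open>Finiteness of algebraic integers with bounded conjugates\<close>

lemma coeff_bound_from_values:
  fixes S :: "complex set"
  assumes "finite S"
  shows "\<exists>C. \<forall>q i. degree q < card S \<longrightarrow> (\<forall>z\<in>S. norm (poly q z) \<le> B) \<longrightarrow> norm (coeff q i) \<le> C"
proof -
  \<comment> \<open>Lagrange basis polynomials for the nodes S: they express coefficients linearly
    through values.\<close>
  define L where "L z = smult (1 / (\<Prod>w\<in>S - {z}. z - w)) (\<Prod>w\<in>S - {z}. [:-w, 1:])" for z
  have Lz: "poly (L z) w = (if w = z then 1 else 0)" if "z \<in> S" "w \<in> S" for z w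
    using that assms by (auto simp: L_def poly_prod)
  have degL: "degree (L z) < card S" if "z \<in> S" for z
  proof -
    have "degree (L z) \<le> degree (\<Prod>w\<in>S - {z}. [:-w, 1:])" by (simp add: L_def degree_smult_le)
    also have "\<dots> = card (S - {z})" by (subst degree_prod_eq_sum_degree) auto
    also have "\<dots> < card S" using that assms by (intro psubset_card_mono) auto
    finally show ?thesis .
  qed
  define C where "C = (\<Sum>i<card S. \<Sum>z\<in>S. \<bar>B\<bar> * norm (coeff (L z) i))"
  have "norm (coeff q i) \<le> C" if q: "degree q < card S" "\<forall>z\<in>S. norm (poly q z) \<le> B" for q i
  proof (cases "i < card S")
    case True
    have "q = (\<Sum>z\<in>S. smult (poly q z) (L z))"
    proof (rule poly_eqI_degree[of S])
      fix w assume "w \<in> S"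
      then have "poly (\<Sum>z\<in>S. smult (poly q z) (L z)) w = (\<Sum>z\<in>S. if w = z then poly q z else 0)"
        unfolding poly_sum by (intro sum.cong) (auto simp: Lz)
      then show "poly q w = poly (\<Sum>z\<in>S. smult (poly q z) (L z)) w"
        using assms \<open>w \<in> S\<close> by simp
    next
      show "degree (\<Sum>z\<in>S. smult (poly q z) (L z)) < card S"
        using q(1) degL by (intro degree_sum_less) (auto intro: le_less_trans[OF degree_smult_le])
    qed (use q in auto)
    then have "coeff q i = (\<Sum>z\<in>S. poly q z * coeff (L z) i)"
      by (metis (mono_tags, lifting) coeff_smult coeff_sum sum.cong)
    then have "norm (coeff q i) \<le> (\<Sum>z\<in>S. norm (poly q z * coeff (L z) i))"
      by (simp add: sum_norm_le)
    also have "\<dots> \<le> (\<Sum>z\<in>S. \<bar>B\<bar> * norm (coeff (L z) i))"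
      using q(2) by (intro sum_mono) (auto simp: norm_mult intro!: mult_right_mono order_trans[OF _ abs_ge_self])
    also have "\<dots> \<le> C" unfolding C_def
      using True by (intro member_le_sum) (auto intro!: sum_nonneg)
    finally show ?thesis .
  next
    case False
    then have "coeff q i = 0" using q(1) by (intro coeff_eq_0) auto
    then show ?thesis by (auto simp: C_def intro!: sum_nonneg)
  qed
  then show ?thesis by blast
qed

lemma finite_bounded_int_polys: "finite {p :: int poly. degree p < n \<and> (\<forall>i. \<bar>coeff p i\<bar> \<le> C)}"
proof -
  have "{p :: int poly. degree p < n \<and> (\<forall>i. \<bar>coeff p i\<bar> \<le> C)}
      \<subseteq> Poly ` {xs. set xs \<subseteq> {-C..C} \<and> length xs \<le> n}"
  proof
    fix p :: "int poly" assume "p \<in> {p. degree p < n \<and> (\<forall>i. \<bar>coeff p i\<bar> \<le> C)}"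
    then have p: "degree p < n" "\<And>i. \<bar>coeff p i\<bar> \<le> C" by auto
    have "p = Poly (coeffs p)" by simp
    moreover have "set (coeffs p) \<subseteq> {-C..C}"
    proof
      fix c assume "c \<in> set (coeffs p)"
      then obtain i where "c = coeff p i"
        using range_coeff by blast
      then show "c \<in> {-C..C}" using p(2)[of i] by auto
    qed
    moreover have "length (coeffs p) \<le> n" using p(1) by (cases "p = 0") (auto simp: length_coeffs_degree)
    ultimately show "p \<in> Poly ` {xs. set xs \<subseteq> {-C..C} \<and> length xs \<le> n}" by blast
  qed
  then show ?thesis by (rule finite_subset) (intro finite_imageI finite_lists_length_le, simp)
qed

lemma ipoly_reduce_monic:
  assumes "lead_coeff m = 1" "ipoly m a = 0"
  shows "\<exists>r. ipoly q a = ipoly r a \<and> degree r \<le> degree m"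
proof -
  have m0: "m \<noteq> 0" using assms by auto
  obtain s r where sr: "pseudo_divmod q m = (s, r)" by fastforce
  have "q = m * s + r" "r = 0 \<or> degree r < degree m"
    using pseudo_divmod[OF m0 sr] assms(1) by simp_all
  then have "ipoly q a = ipoly r a \<and> degree r \<le> degree m" using assms(2) by auto
  then show ?thesis by blast
qed

text \<open>
  Pseudo-division by the minimal polynomial introduces only a fixed denominator, as the degree
  can be bounded first by means of a monic relation.
\<close>

lemma finite_bounded_conjugates:
  fixes a :: complex
  assumes m: "lead_coeff m = 1" "ipoly m a = 0"
  shows "finite {ipoly q a | q. \<forall>z. is_conj a z \<longrightarrow> norm (ipoly q z) \<le> B}"
proof -
  have m0: "m \<noteq> 0" using m by auto
  then obtain p where p: "is_min_poly a p" using min_poly_exists m by blast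
  have p0: "p \<noteq> 0" using p by (simp add: is_min_poly_def)
  define c where "c = lead_coeff p"
  have c0: "c \<noteq> 0" using p0 by (simp add: c_def)
  \<comment> \<open>The largest power of \<open>c\<close> that pseudo-division can need in degree at
    most \<open>degree m\<close>. Padding every remainder to this exponent makes the denominator
    independent of the element.\<close>
  define k where "k = c ^ Suc (degree m)"
  have k0: "k \<noteq> 0" using c0 by (simp add: k_def)
  let ?S = "{z. is_conj a z}"
  obtain C where C: "\<And>q i. degree q < card ?S \<Longrightarrow> \<forall>z\<in>?S. norm (poly q z) \<le> norm (of_int k :: complex) * B
      \<Longrightarrow> norm (coeff q i) \<le> C"
    using coeff_bound_from_values[OF card_conjugates(1)[OF p]] by meson
  let ?F = "{r :: int poly. degree r < degree p \<and> (\<forall>i. \<bar>coeff r i\<bar> \<le> \<lceil>C\<rceil>)}"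
  have "{ipoly q a | q. \<forall>z. is_conj a z \<longrightarrow> norm (ipoly q z) \<le> B} \<subseteq> (\<lambda>r. ipoly r a / of_int k) ` ?F"
  proof
    fix x assume "x \<in> {ipoly q a | q. \<forall>z. is_conj a z \<longrightarrow> norm (ipoly q z) \<le> B}"
    then obtain q0 where x: "x = ipoly q0 a" and q0: "\<And>z. is_conj a z \<Longrightarrow> norm (ipoly q0 z) \<le> B" by blast
    obtain q where q: "ipoly q0 a = ipoly q a" "degree q \<le> degree m"
      using ipoly_reduce_monic[OF m] by blast
    have qz: "ipoly q0 z = ipoly q z" if "is_conj a z" for z
    proof -
      have "ipoly (q0 - q) a = 0" using q by simp
      then have "ipoly (q0 - q) z = 0" using that unfolding is_conj_def by blast
      then show ?thesis by simp
    qed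
    obtain s r where sr: "pseudo_divmod q p = (s, r)" by fastforce
    define e where "e = Suc (degree q) - degree p"
    have eq: "smult (c ^ e) q = p * s + r" and deg: "r = 0 \<or> degree r < degree p"
      using pseudo_divmod[OF p0 sr] by (simp_all add: c_def e_def)
    define r' where "r' = smult (c ^ (Suc (degree m) - e)) r"
    have e: "e \<le> Suc (degree m)" using q(2) by (simp add: e_def)
    have r'z: "ipoly r' z = of_int k * ipoly q z" if "is_conj a z" for z
    proof -
      have "ipoly p z = 0" using that min_poly_roots[OF p] by simp
      moreover have "ipoly (smult (c ^ e) q) z = ipoly (p * s + r) z" by (simp only: eq)
      ultimately have "ipoly r z = of_int (c ^ e) * ipoly q z" by simp
      moreover have "k = c ^ (Suc (degree m) - e) * c ^ e"
        using e by (simp add: k_def flip: power_add)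
      ultimately show ?thesis by (simp add: r'_def)
    qed
    have aa: "is_conj a a" by (simp add: is_conj_def)
    have dp: "degree p > 0"
    proof (rule ccontr)
      assume "\<not> degree p > 0"
      then obtain d where "p = [:d:]" by (metis degree_eq_zeroE not_gr_zero)
      then show False using p by (simp add: is_min_poly_def)
    qed
    then have degr': "degree r' < degree p" using deg unfolding r'_def
      by (metis degree_0 degree_smult_le le_less_trans smult_0_right)
    have "\<bar>coeff r' i\<bar> \<le> \<lceil>C\<rceil>" for i
    proof -
      have "norm (coeff (map_poly of_int r' :: complex poly) i) \<le> C"
      proof (rule C)
        show "degree (map_poly of_int r' :: complex poly) < card ?S"
          using degr' card_conjugates(2)[OF p] by (simp add: degree_map_poly)
        show "\<forall>z\<in>?S. norm (ipoly r' z) \<le> norm (of_int k :: complex) * B"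
        proof
          fix z assume "z \<in> ?S"
          then have "is_conj a z" by simp
          then show "norm (ipoly r' z) \<le> norm (of_int k :: complex) * B"
            using r'z[of z] qz[of z] q0[of z] by (simp add: norm_mult mult_left_mono)
        qed
      qed
      then have "\<bar>real_of_int (coeff r' i)\<bar> \<le> C" by (simp add: coeff_map_poly)
      then show ?thesis by linarith
    qed
    moreover have "x = ipoly r' a / of_int k"
      using r'z[OF aa] k0 x q(1) by simp
    ultimately show "x \<in> (\<lambda>r. ipoly r a / of_int k) ` ?F" using degr' by blast
  qed
  then show ?thesis by (rule finite_subset) (intro finite_imageI finite_bounded_int_polys)
qed

text \<open>Reducing by the monic relation and taking coefficients modulo k leaves finitely many
  representatives for the powers of a, so two of them agree.\<close>

lemma power_congruence_mod:
  fixes a :: complex and k :: int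
  assumes m: "lead_coeff m = 1" "ipoly m a = 0" and k: "k > 0"
  shows "\<exists>i j q. i < j \<and> a ^ j - a ^ i = of_int k * ipoly q a"
proof -
  let ?M = "monom 1 :: nat \<Rightarrow> int poly"
  have ex: "\<forall>i. \<exists>r. ipoly (?M i) a = ipoly r a \<and> degree r \<le> degree m"
    using ipoly_reduce_monic[OF m] by blast
  then obtain f where f: "\<And>i. ipoly (?M i) a = ipoly (f i) a" "\<And>i. degree (f i) \<le> degree m" by metis
  have mon: "ipoly (?M i) a = a ^ i" for i
    by (induction i) (simp_all add: monom_Suc monom_0)
  define h where "h i = map_poly (\<lambda>c. c mod k) (f i)" for i
  have "range h \<subseteq> {p. degree p < Suc (degree m) \<and> (\<forall>i. \<bar>coeff p i\<bar> \<le> k)}"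
  proof safe
    fix i
    show "degree (h i) < Suc (degree m)" using f(2)[of i] map_poly_degree_leq[of "\<lambda>c. c mod k" "f i"]
      by (simp add: h_def)
    fix l
    show "\<bar>coeff (h i) l\<bar> \<le> k" using k by (simp add: h_def coeff_map_poly order_less_imp_le)
  qed
  then have "finite (range h)" by (rule finite_subset) (rule finite_bounded_int_polys)
  then have "\<not> inj h" using finite_imageD[of h UNIV] by auto
  then obtain i j where ij: "h i = h j" "i \<noteq> j" by (auto simp: inj_def)
  have gen: "\<exists>i j q. i < j \<and> a ^ j - a ^ i = of_int k * ipoly q a" if "h i = h j" "i < j" for i j
  proof -
    define q where "q = map_poly (\<lambda>c. c div k) (f j - f i)"
    have "f j - f i = smult k q"
    proof (rule poly_eqI)
      fix n
      have "coeff (h i) n = coeff (h j) n" using that by simp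
      then have "coeff (f i) n mod k = coeff (f j) n mod k" by (simp add: h_def coeff_map_poly)
      then have "k dvd coeff (f j) n - coeff (f i) n" by (metis mod_eq_dvd_iff)
      then show "coeff (f j - f i) n = coeff (smult k q) n" by (simp add: q_def coeff_map_poly)
    qed
    then have "ipoly (f j - f i) a = of_int k * ipoly q a" by simp
    then have "a ^ j - a ^ i = of_int k * ipoly q a" using f(1) mon by simp
    then show ?thesis using that by blast
  qed
  show ?thesis using gen[of i j] gen[of j i] ij by (metis linorder_neqE_nat)
qed

section \<open>Reciprocal polynomials, simultaneous small values, and closure of the ring\<close>

lemma ipoly_reflect_poly:
  fixes z :: "'a :: field_char_0"
  assumes "z \<noteq> 0"
  shows "ipoly (reflect_poly p) z = z ^ degree p * ipoly p (1 / z)"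
proof -
  have "map_poly (of_int :: int \<Rightarrow> 'a) (reflect_poly p) = reflect_poly (map_poly of_int p)"
    by (rule poly_eqI) (simp add: coeff_map_poly coeff_reflect_poly degree_map_poly)
  then show ?thesis
    using assms by (simp add: poly_reflect_poly_nz degree_map_poly inverse_eq_divide)
qed

lemma ipoly_cnj: "ipoly p (cnj z) = cnj (ipoly p z)"
  by (induction p) simp_all

text \<open>Dirichlet's box principle: three free coefficients against two smallness
  conditions.\<close>

lemma small_quadratic_values:
  fixes a b \<delta> :: real
  assumes "a > 0" "b > 0" "\<delta> > 0"
  shows "\<exists>p :: int poly. p \<noteq> 0 \<and> degree p \<le> 2 \<and> \<bar>ipoly p a\<bar> < \<delta> \<and> \<bar>ipoly p b\<bar> < \<delta>"
proof -
  define c where "c = max (1 + a + a\<^sup>2) (1 + b + b\<^sup>2) / \<delta>"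
  define M where "M = nat \<lceil>c\<rceil>"
  \<comment> \<open>The values at a and at b, in units of \<delta>, lie between 0 and M H. The
    choice of \<open>H\<close> gives (M H + 1)^2 <= ((M + 1) H)^2 = H^3 < (H + 1)^3, so there are
    more polynomials than boxes.\<close>
  define H where "H = (M + 1)\<^sup>2"
  define P where "P = (\<lambda>(i, j, k). [:int i, int j, int k:])"
  define h where "h t = (nat \<lfloor>ipoly (P t) a / \<delta>\<rfloor>, nat \<lfloor>ipoly (P t) b / \<delta>\<rfloor>)" for t
  let ?A = "{..H} \<times> {..H} \<times> {..H}"
  have cM: "c \<le> real M" unfolding M_def by (simp add: real_nat_ceiling_ge)
  have val: "0 \<le> ipoly (P t) s / \<delta> \<and> ipoly (P t) s / \<delta> \<le> real (M * H)"
    if s: "s > 0" "1 + s + s\<^sup>2 \<le> c * \<delta>" and t: "t \<in> ?A" for s t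
  proof -
    obtain i j k where ijk: "t = (i, j, k)" by (cases t)
    have *: "ipoly (P t) s = i + s * j + s\<^sup>2 * k"
      by (simp add: ijk P_def power2_eq_square algebra_simps)
    have "ipoly (P t) s \<le> H + s * H + s\<^sup>2 * H"
      unfolding * using t s by (intro add_mono mult_left_mono) (auto simp: ijk)
    also have "\<dots> = (1 + s + s\<^sup>2) * H" by (simp add: algebra_simps)
    also have "\<dots> \<le> c * \<delta> * H" using s by (intro mult_right_mono) auto
    also have "\<dots> \<le> M * \<delta> * H" using cM assms by (intro mult_right_mono) auto
    finally have "ipoly (P t) s \<le> real (M * H) * \<delta>" by (simp add: mult_ac)
    then show ?thesis using * s assms(3) by (simp add: field_simps)
  qed
  have ab: "1 + a + a\<^sup>2 \<le> c * \<delta>" "1 + b + b\<^sup>2 \<le> c * \<delta>"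
    using assms by (simp_all add: c_def)
  have "h ` ?A \<subseteq> {..M * H} \<times> {..M * H}"
  proof
    fix y assume "y \<in> h ` ?A"
    then obtain t where t: "t \<in> ?A" "y = h t" by blast
    have "nat \<lfloor>ipoly (P t) a / \<delta>\<rfloor> \<le> M * H" using val[OF assms(1) ab(1) t(1)] by linarith
    moreover have "nat \<lfloor>ipoly (P t) b / \<delta>\<rfloor> \<le> M * H" using val[OF assms(2) ab(2) t(1)] by linarith
    ultimately show "y \<in> {..M * H} \<times> {..M * H}" by (simp add: t h_def)
  qed
  then have "card (h ` ?A) \<le> card ({..M * H} \<times> {..M * H})" by (intro card_mono) auto
  also have "\<dots> = (M * H + 1) * (M * H + 1)" by (simp add: card_cartesian_product)
  also have "\<dots> \<le> ((M + 1) * H) * ((M + 1) * H)"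
    by (intro mult_mono) (auto simp: H_def)
  also have "\<dots> = H * H * H" by (simp add: H_def power2_eq_square algebra_simps)
  also have "\<dots> < (H + 1) * (H + 1) * (H + 1)" by (intro mult_strict_mono) auto
  also have "\<dots> = card ?A" by (simp add: card_cartesian_product)
  finally have "\<not> inj_on h ?A" using pigeonhole by blast
  then obtain t t' where tt: "t \<in> ?A" "t' \<in> ?A" "h t = h t'" "t \<noteq> t'" by (auto simp: inj_on_def)
  define p where "p = P t - P t'"
  have "P t \<noteq> P t'" using tt(4) by (cases t; cases t') (auto simp: P_def)
  moreover have "degree p \<le> 2" unfolding p_def P_def
    by (cases t; cases t') (auto simp: degree_pCons_le intro: order_trans[OF degree_pCons_le])
  moreover have "\<bar>ipoly p s\<bar> < \<delta>"
    if s: "s > 0" "1 + s + s\<^sup>2 \<le> c * \<delta>" "nat \<lfloor>ipoly (P t) s / \<delta>\<rfloor> = nat \<lfloor>ipoly (P t') s / \<delta>\<rfloor>" for s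
  proof -
    have "0 \<le> ipoly (P t) s / \<delta>" "0 \<le> ipoly (P t') s / \<delta>" using val s tt by blast+
    then have "\<lfloor>ipoly (P t) s / \<delta>\<rfloor> = \<lfloor>ipoly (P t') s / \<delta>\<rfloor>" using s(3) by linarith
    then have "\<bar>ipoly (P t) s / \<delta> - ipoly (P t') s / \<delta>\<bar> < 1" by linarith
    then show ?thesis using assms(3) by (simp add: p_def field_simps flip: diff_divide_distrib)
  qed
  ultimately show ?thesis using assms ab tt(3)
    by (intro exI[of _ p]) (auto simp: p_def h_def)
qed

lemma int_poly_ring_closed:
  shows "x \<in> int_poly_ring \<beta> \<Longrightarrow> y \<in> int_poly_ring \<beta> \<Longrightarrow> x * y \<in> int_poly_ring \<beta>"
    and "x \<in> int_poly_ring \<beta> \<Longrightarrow> ipoly q x \<in> int_poly_ring \<beta>"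
    and "\<beta> ^ n \<in> int_poly_ring \<beta>"
    and "of_int k \<in> int_poly_ring \<beta>"
proof -
  have R: "z \<in> int_poly_ring \<beta> \<longleftrightarrow> (\<exists>p. z = ipoly p \<beta>)" for z
    by (auto simp: int_poly_ring_def)
  show *: "x * y \<in> int_poly_ring \<beta>" if "x \<in> int_poly_ring \<beta>" "y \<in> int_poly_ring \<beta>" for x y
    using that unfolding R by (metis ipoly_mult)
  show k: "of_int k \<in> int_poly_ring \<beta>" for k
    unfolding R by (rule exI[of _ "[:k:]"]) simp
  show "ipoly q x \<in> int_poly_ring \<beta>" if x: "x \<in> int_poly_ring \<beta>"
  proof (induction q)
    case 0
    then show ?case using k[of 0] by simp
  next
    case (pCons c q)
    have "x * ipoly q x \<in> int_poly_ring \<beta>" using x pCons * by blast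
    then show ?case using k[of c] unfolding R by (metis ipoly_simps(2,5))
  qed
  show "\<beta> ^ n \<in> int_poly_ring \<beta>"
    unfolding R by (rule exI[of _ "[:0, 1:] ^ n"]) simp
qed

context neg_base
begin

subsection \<open>Finite expansions\<close>

lemma d_neg_sums:
  assumes "y \<in> I"
  shows "(\<lambda>i. of_int (d_neg \<beta> y i) * (- 1 / \<beta>) ^ Suc i) sums y"
proof -
  have part: "(\<Sum>i<n. of_int (d_neg \<beta> y i) * (- 1 / \<beta>) ^ Suc i) = y - (- 1 / \<beta>) ^ n * (T ^^ n) y" for n
  proof (induction n)
    case (Suc n)
    have "(- 1 / \<beta>) * T ((T ^^ n) y) = (T ^^ n) y + of_int (d_neg \<beta> y n) / \<beta>"
      using \<beta>_gt_1 by (simp add: T_eq d_neg_eq field_simps)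
    then have "(- 1 / \<beta>) ^ Suc n * (T ^^ Suc n) y = (- 1 / \<beta>) ^ n * ((T ^^ n) y + of_int (d_neg \<beta> y n) / \<beta>)"
      by (metis funpow.simps(2) mult.assoc o_apply power_Suc2)
    then show ?case using Suc by (simp add: algebra_simps)
  qed simp
  have "(\<lambda>n. y - (- 1 / \<beta>) ^ n * (T ^^ n) y) \<longlonglongrightarrow> y - 0"
  proof (intro tendsto_intros)
    have "(\<lambda>n. (1 / \<beta>) ^ n) \<longlonglongrightarrow> 0" using \<beta>_gt_1 by (intro LIMSEQ_power_zero) simp
    moreover have "norm ((- 1 / \<beta>) ^ n * (T ^^ n) y) \<le> (1 / \<beta>) ^ n" for n
    proof -
      have "lend > - 1" using \<beta>_gt_1 by (simp add: field_simps)
      then have "\<bar>(T ^^ n) y\<bar> \<le> 1"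
        using funpow_T_mem_I[OF assms, of n] rend_eq lend_lt_0 unfolding mem_I by linarith
      then have "(1 / \<beta>) ^ n * \<bar>(T ^^ n) y\<bar> \<le> (1 / \<beta>) ^ n * 1"
        using \<beta>_gt_1 by (intro mult_left_mono) auto
      then show ?thesis using \<beta>_gt_1 by (simp add: abs_mult power_abs)
    qed
    ultimately show "(\<lambda>n. (- 1 / \<beta>) ^ n * (T ^^ n) y) \<longlonglongrightarrow> 0"
      by (rule Lim_null_comparison[OF always_eventually[OF allI], rotated])
  qed
  then show ?thesis unfolding sums_def part by simp
qed

text \<open>Turns a finite expansion into a statement about \<open>T\<close>: y is the point whose
  digit string is the admissible string with the leading zero.\<close>

lemma Fin_neg_cases:
  assumes "x \<in> Fin_neg \<beta>" "x \<noteq> 0"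
  obtains k y M where "y \<in> I" "digit y = 0" "(T ^^ M) y = 0" "x = (- \<beta>) powi k * y"
proof -
  obtain n s where s: "is_neg_expansion \<beta> x n s" "ends_in_zeros s"
    using assms by (auto simp: Fin_neg_def)
  then obtain y where y: "y \<in> I" "[0] \<frown> s = d_neg \<beta> y"
    and sums: "(\<lambda>i. of_int (s i) * (- \<beta>) powi (n - int i)) sums x"
    by (auto simp: is_neg_expansion_def neg_admissible_def)
  have d0: "d_neg \<beta> y 0 = 0" and dS: "d_neg \<beta> y (Suc i) = s i" for i
    using y(2) by (simp_all add: conc_def flip: y(2))
  have "digit y = 0" using d0 by (simp add: d_neg_eq)
  obtain v where v: "s = v \<frown> [0]\<^sup>\<omega>" using s(2) by (auto simp: ends_in_zeros_def)
  define M where "M = Suc (length v)"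
  have "d_neg \<beta> ((T ^^ M) y) = d_neg \<beta> 0"
  proof
    fix i
    have "d_neg \<beta> ((T ^^ M) y) i = d_neg \<beta> y (M + i)" by (rule d_neg_funpow)
    also have "\<dots> = s (length v + i)" by (simp add: M_def dS)
    also have "\<dots> = 0" unfolding v by (simp add: conc_def)
    also have "0 = d_neg \<beta> 0 i" by (simp add: d_neg_eq funpow_T_0 digit_zero)
    finally show "d_neg \<beta> ((T ^^ M) y) i = d_neg \<beta> 0 i" .
  qed
  then have "(T ^^ M) y = 0" by (intro d_neg_inj funpow_T_mem_I y(1) zero_mem_I)
  \<comment> \<open>Behind the leading zero the first digit of s has exponent -2 in y and exponent n
    in x, hence the shift n + 2.\<close>
  moreover have "x = (- \<beta>) powi (n + 2) * y"
  proof -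
    have "(\<lambda>i. of_int (d_neg \<beta> y (Suc i)) * (- 1 / \<beta>) ^ Suc (Suc i)) sums y"
      using sums_Suc_iff[of "\<lambda>i. of_int (d_neg \<beta> y i) * (- 1 / \<beta>) ^ Suc i" y] d_neg_sums[OF y(1)] d0 by simp
    then have "(\<lambda>i. (- \<beta>) powi (n + 2) * (of_int (s i) * (- 1 / \<beta>) ^ Suc (Suc i))) sums ((- \<beta>) powi (n + 2) * y)"
      unfolding dS by (rule sums_mult)
    moreover have "(- \<beta>) powi (n + 2) * (of_int (s i) * (- 1 / \<beta>) ^ Suc (Suc i)) = of_int (s i) * (- \<beta>) powi (n - int i)" for i
    proof -
      have inv: "- 1 / \<beta> = inverse (- \<beta>)" by (simp add: inverse_eq_divide)
      have "(- 1 / \<beta>) ^ Suc (Suc i) = (- \<beta>) powi (- int (Suc (Suc i)))"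
        unfolding inv by (simp only: power_int_minus power_int_of_nat power_inverse)
      moreover have "(- \<beta>) powi (n + 2) * (- \<beta>) powi (- int (Suc (Suc i))) = (- \<beta>) powi (n - int i)"
        using \<beta>_gt_1 by (subst power_int_add[symmetric]) (auto simp: algebra_simps)
      ultimately show ?thesis by (metis mult.left_commute)
    qed
    ultimately show ?thesis using sums sums_unique2 by simp
  qed
  ultimately show ?thesis using that y(1) \<open>digit y = 0\<close> by blast
qed

text \<open>Multiplication by (-1/\<beta>)^j prepends j zero digits; the bound keeps all
  intermediate points in \<open>I\<close>.\<close>

lemma funpow_T_scaled:
  assumes "\<bar>x\<bar> < rend"
  shows "(T ^^ j) ((- 1 / \<beta>) ^ j * x) = x"
proof (induction j)
  case (Suc j)
  have "\<bar>(- 1 / \<beta>) ^ j * x\<bar> \<le> 1 * \<bar>x\<bar>"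
    unfolding abs_mult using \<beta>_gt_1 by (intro mult_right_mono) (auto simp: power_abs power_le_one)
  then have "(- 1 / \<beta>) ^ j * x \<in> I" using assms by (intro small_mem_I) simp
  then have "T ((- 1 / \<beta>) ^ Suc j * x) = (- 1 / \<beta>) ^ j * x"
    by (rule T_eqI[where k = 0]) (use \<beta>_gt_1 in simp)
  then show ?case using Suc by (simp add: funpow_swap1)
qed simp

text \<open>Write x = (-\<beta>)^k y with y reaching 0. For k >= 0 the point x lies on the orbit of
  y; for k < 0 the point y lies on the orbit of x.\<close>

lemma Fin_neg_small:
  assumes "x \<in> Fin_neg \<beta>" "\<bar>x\<bar> < rend"
  shows "\<exists>n. (T ^^ n) x = 0"
proof (cases "x = 0")
  case True
  then show ?thesis using funpow_T_0 by blast
next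
  case False
  then obtain k y M where y: "y \<in> I" "digit y = 0" "(T ^^ M) y = 0" and x: "x = (- \<beta>) powi k * y"
    using Fin_neg_cases assms(1) by blast
  show ?thesis
  proof (cases "k \<ge> 0")
    case True
    then obtain j where "k = int j" using nonneg_int_cases by blast
    then have "y = (- 1 / \<beta>) ^ j * x" using x \<beta>_gt_1
      by (simp add: mult.assoc[symmetric] flip: power_mult_distrib)
    then have "(T ^^ j) y = x" using funpow_T_scaled assms(2) by simp
    then have "(T ^^ M) x = (T ^^ (M + j)) y" by (simp add: funpow_add)
    then have "(T ^^ M) x = 0" using funpow_T_zero_mono[OF y(3)] by simp
    then show ?thesis ..
  next
    case False
    then obtain j where j: "k = - int (Suc j)" by (metis int_cases not_less of_nat_0_le_iff)
    define z where "z = - 1 / \<beta> * y"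
    \<comment> \<open>Gives |y| < \<beta>/(\<beta> + 1) strictly. The bound \<open>rend\<close> may
      fail for y, but holds for z = -y/\<beta>, so one zero digit is split off before
      \<open>funpow_T_scaled\<close> applies.\<close>
    have "y \<noteq> lend"
    proof
      assume "y = lend"
      then have "T lend = \<beta> * (\<beta> / (\<beta> + 1))" using y(2) by (simp add: T_eq)
      moreover have "\<beta> * (\<beta> / (\<beta> + 1)) > 1 * (1 / (\<beta> + 1))"
        using \<beta>_gt_1 by (intro mult_strict_mono divide_strict_right_mono) auto
      ultimately show False using T_mem_I[of lend] by (simp add: mem_I)
    qed
    then have "lend < y" "y < rend" using y(1) by (simp_all add: mem_I)
    moreover have "rend < - lend" using \<beta>_gt_1 by (simp add: divide_strict_right_mono)
    ultimately have "\<bar>y\<bar> < - lend" by linarith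
    then have "1 / \<beta> * \<bar>y\<bar> < 1 / \<beta> * - lend" using \<beta>_gt_1 by (intro mult_strict_left_mono) auto
    then have "\<bar>z\<bar> < rend" using \<beta>_gt_1 by (simp add: z_def abs_mult)
    moreover have "x = (- 1 / \<beta>) ^ j * z"
    proof -
      have "(- \<beta>) powi k = (- 1 / \<beta>) ^ Suc j"
        unfolding j using \<beta>_gt_1 by (simp only: power_int_minus power_int_of_nat power_inverse[symmetric]) (simp add: inverse_eq_divide)
      then show ?thesis using x by (simp add: z_def mult_ac)
    qed
    ultimately have "(T ^^ j) x = z" using funpow_T_scaled by simp
    moreover have "T z = y" by (rule T_eqI[OF y(1), where k = 0]) (use \<beta>_gt_1 in \<open>simp add: z_def\<close>)
    ultimately have "(T ^^ Suc j) x = y" by simp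
    then have "(T ^^ (M + Suc j)) x = 0" using y(3) by (simp only: funpow_add o_apply)
    then show ?thesis ..
  qed
qed

lemma Fin_neg_divide:
  assumes "x \<in> Fin_neg \<beta>"
  shows "- x / \<beta> \<in> Fin_neg \<beta>"
proof (cases "x = 0")
  case False
  then obtain n s where s: "is_neg_expansion \<beta> x n s" "ends_in_zeros s"
    using assms by (auto simp: Fin_neg_def)
  have "(\<lambda>i. (- 1 / \<beta>) * (of_int (s i) * (- \<beta>) powi (n - int i))) sums ((- 1 / \<beta>) * x)"
    using s(1) unfolding is_neg_expansion_def by (intro sums_mult) simp
  moreover have "(- 1 / \<beta>) * (of_int (s i) * (- \<beta>) powi (n - int i)) = of_int (s i) * (- \<beta>) powi (n - 1 - int i)" for i
  proof -
    have "(- \<beta>) powi (n - 1 - int i) = (- \<beta>) powi (n - int i) / (- \<beta>)"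
      using \<beta>_gt_1 power_int_diff[of "- \<beta>" "n - int i" 1] by (simp add: algebra_simps)
    then show ?thesis using \<beta>_gt_1 by simp
  qed
  ultimately have "is_neg_expansion \<beta> (- x / \<beta>) (n - 1) s"
    using s(1) unfolding is_neg_expansion_def by simp
  then show ?thesis using s(2) False \<beta>_gt_1 unfolding Fin_neg_def by auto
qed (use assms in simp)

end

subsection \<open>Consequences of the finiteness property\<close>

locale neg_base_finite = neg_base +
  assumes Fin_eq: "Fin_neg \<beta> = int_poly_ring \<beta>"
begin

definition ib :: complex where "ib = of_real (1 / \<beta>)"

lemma ipoly_ib: "ipoly p ib = of_real (ipoly p (1 / \<beta>))"
  unfolding ib_def by (rule ipoly_of_real)

lemma ib_nonzero: "ib \<noteq> 0"
  using \<beta>_gt_1 by (simp add: ib_def)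

lemma small_reaches_0:
  assumes "x \<in> int_poly_ring \<beta>" "\<bar>x\<bar> < rend"
  shows "\<exists>n. (T ^^ n) x = 0"
  using Fin_neg_small assms Fin_eq by blast

text \<open>Finite expansions survive division by -\<beta>, as only the exponent moves; applied to
  1, this makes \<beta> a unit.\<close>

lemma minus_inverse_mem: "- 1 / \<beta> \<in> int_poly_ring \<beta>"
proof -
  have "1 \<in> int_poly_ring \<beta>" using int_poly_ring_closed(4)[of 1 \<beta>] by simp
  then show ?thesis using Fin_neg_divide[of 1] Fin_eq by simp
qed

lemma inverse_mem: "1 / \<beta> \<in> int_poly_ring \<beta>"
  using int_poly_ring_closed(1)[OF int_poly_ring_closed(4)[of "- 1"] minus_inverse_mem] by simp

lemma ipoly_inverse_mem: "ipoly q (1 / \<beta>) \<in> int_poly_ring \<beta>"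
  by (rule int_poly_ring_closed(2)[OF inverse_mem])

text \<open>Multiplying p(\<beta>) = -1/\<beta> by (1/\<beta>)^(degree p) gives a monic relation for
  1/\<beta>, which is therefore an algebraic integer.\<close>

lemma monic_relation: "\<exists>m. lead_coeff m = 1 \<and> ipoly m ib = 0"
proof -
  obtain p :: "int poly" where p: "ipoly p \<beta> = - 1 / \<beta>"
    using minus_inverse_mem by (auto simp: int_poly_ring_def)
  define m where "m = reflect_poly p + monom 1 (Suc (degree p))"
  have deg: "degree (reflect_poly p) < degree (monom (1::int) (Suc (degree p)))"
    using degree_reflect_poly_le[of p] by (simp add: degree_monom_eq)
  then have "lead_coeff m = 1"
    unfolding m_def by (subst lead_coeff_add_le) (simp_all add: degree_monom_eq)
  moreover have "ipoly m (1 / \<beta>) = 0"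
  proof -
    have "ipoly (monom 1 n) (1 / \<beta>) = (1 / \<beta>) ^ n" for n
      by (induction n) (simp_all add: monom_Suc monom_0)
    moreover have "ipoly (reflect_poly p) (1 / \<beta>) = (1 / \<beta>) ^ degree p * (- 1 / \<beta>)"
      using \<beta>_gt_1 by (subst ipoly_reflect_poly) (simp_all add: p)
    ultimately show ?thesis by (simp add: m_def)
  qed
  ultimately show ?thesis using ipoly_ib by (intro exI[of _ m]) simp
qed

lemma ib_conj_sym:
  assumes "is_conj ib z"
  shows "is_conj z ib"
proof -
  obtain m where m: "lead_coeff m = 1" "ipoly m ib = 0" using monic_relation by blast
  then have "m \<noteq> 0" by auto
  then show ?thesis using is_conj_sym m assms by blast
qed

lemma conj_nonzero:
  assumes "is_conj ib z"
  shows "z \<noteq> 0"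
proof
  assume "z = 0"
  then have "ipoly [:0, 1:] z = 0" by simp
  then have "ipoly [:0, 1:] ib = 0" using ib_conj_sym[OF assms] unfolding is_conj_def by blast
  then show False using ib_nonzero by simp
qed

lemma conj_eqI:
  assumes "is_conj ib z" "ipoly p (1 / \<beta>) = ipoly q (1 / \<beta>)"
  shows "ipoly p z = ipoly q z"
proof -
  have "ipoly (p - q) ib = 0" unfolding ipoly_ib using assms(2) by simp
  then have "ipoly (p - q) z = 0" using assms(1) unfolding is_conj_def by blast
  then show ?thesis by simp
qed

lemma dpoly_value:
  assumes "(T ^^ n) x = 0"
  shows "ipoly (dpoly n x) (1 / \<beta>) = x"
  using ipoly_dpoly[of x n] assms by simp

section \<open>Location of the conjugates of 1/\<beta>\<close>

lemma conj_norm_ge_1: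
  assumes z: "is_conj ib z" "z \<noteq> ib"
  shows "norm z \<ge> 1"
proof (rule ccontr)
  assume "\<not> norm z \<ge> 1"
  then have nz: "norm z < 1" by simp
  have z0: "z \<noteq> 0" using z(1) by (rule conj_nonzero)
  define B where "B = \<beta> * norm z / (1 - norm z)"
  obtain e where e: "(1 / \<beta>) ^ Suc e < rend"
  proof -
    obtain e where "(1 / \<beta>) ^ e < rend"
      using real_arch_pow_inv[OF rend_gt_0, of "1 / \<beta>"] \<beta>_gt_1 by auto
    moreover have "(1 / \<beta>) ^ Suc e \<le> (1 / \<beta>) ^ e"
      using \<beta>_gt_1 by (intro power_decreasing) auto
    ultimately show thesis using that[of e] by linarith
  qed
  have bound: "norm z ^ e * (real k * norm (1 - of_real \<beta> * z)) \<le> B + norm z ^ e * norm z" for k :: nat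
  proof -
    define m where "m = \<lfloor>k * \<beta>\<rfloor>"
    define t where "t = k * \<beta> - m"
    \<comment> \<open>At 1/\<beta> this is (1/\<beta>)^(e + 1) times the fractional part of k
      \<beta>, small for every k. At z it is z^e (k (1 - \<beta> z) + t z), unbounded in k unless z
      = 1/\<beta>.\<close>
    define q where "q = [:0, 1:] ^ e * [:int k, - m:]"
    have t: "0 \<le> t" "t < 1" unfolding t_def m_def by linarith+
    have val: "ipoly q (1 / \<beta>) = (1 / \<beta>) ^ Suc e * t"
      using \<beta>_gt_1 by (simp add: q_def t_def field_simps)
    define x where "x = (1 / \<beta>) ^ Suc e * t"
    have "\<bar>x\<bar> \<le> (1 / \<beta>) ^ Suc e * 1"
      unfolding x_def abs_mult using t \<beta>_gt_1 by (intro mult_mono) auto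
    then have small: "\<bar>x\<bar> < rend" using e by linarith
    moreover have "x \<in> int_poly_ring \<beta>" using ipoly_inverse_mem[of q] val x_def by simp
    ultimately obtain n where n: "(T ^^ n) x = 0" using small_reaches_0 by blast
    have "ipoly q z = ipoly (dpoly n x) z"
      using z(1) dpoly_value[OF n] val x_def by (intro conj_eqI) simp_all
    then have "norm (ipoly q z) \<le> B"
      unfolding B_def using ipoly_dpoly_conj_bound[OF small_mem_I[OF small] nz] by simp
    moreover have "ipoly q z = z ^ e * (of_nat k * (1 - of_real \<beta> * z) + of_real t * z)"
      by (simp add: q_def t_def algebra_simps)
    ultimately have "norm z ^ e * norm (of_nat k * (1 - of_real \<beta> * z) + of_real t * z) \<le> B"
      by (simp add: norm_mult norm_power)
    moreover have "real k * norm (1 - of_real \<beta> * z)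
        \<le> norm (of_nat k * (1 - of_real \<beta> * z) + of_real t * z) + norm z"
    proof -
      have "norm (of_nat k * (1 - of_real \<beta> * z))
          \<le> norm (of_nat k * (1 - of_real \<beta> * z) + of_real t * z) + norm (of_real t * z)"
        using norm_triangle_ineq4[of "of_nat k * (1 - of_real \<beta> * z) + of_real t * z" "of_real t * z"] by simp
      moreover have "norm (of_real t * z) \<le> 1 * norm z"
        using t by (simp add: norm_mult mult_left_le_one_le)
      moreover have "norm (of_nat k * (1 - of_real \<beta> * z)) = real k * norm (1 - of_real \<beta> * z)"
        by (simp add: norm_mult)
      ultimately show ?thesis by simp
    qed
    then have "norm z ^ e * (real k * norm (1 - of_real \<beta> * z))
        \<le> norm z ^ e * (norm (of_nat k * (1 - of_real \<beta> * z) + of_real t * z) + norm z)"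
      by (intro mult_left_mono) auto
    ultimately show ?thesis by (simp add: distrib_left)
  qed
  define c where "c = norm z ^ e * norm (1 - of_real \<beta> * z)"
  have "1 - of_real \<beta> * z \<noteq> 0"
  proof
    assume "1 - of_real \<beta> * z = 0"
    then have "z = ib" using \<beta>_gt_1 by (simp add: ib_def field_simps)
    then show False using z(2) by simp
  qed
  then have "c > 0" using z0 by (simp add: c_def)
  then obtain k :: nat where "B + norm z ^ e * norm z < real k * c"
    using reals_Archimedean3 by blast
  then show False using bound[of k] by (simp add: c_def mult_ac)
qed

text \<open>On the unit circle 1/z is the complex conjugate of z, so integer relations of z also
  hold at 1/z. Passing to reciprocal polynomials moves this symmetry from z to 1/\<beta>.\<close>

lemma base_is_conj:
  assumes z: "is_conj ib z" "norm z = 1"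
  shows "is_conj ib (of_real \<beta>)"
  unfolding is_conj_def
proof (intro allI impI)
  fix q assume "ipoly q ib = 0"
  then have "ipoly q z = 0" using z(1) by (simp add: is_conj_def)
  then have "ipoly q (cnj z) = 0" by (simp add: ipoly_cnj)
  moreover have "cnj z = 1 / z"
    using z(2) by (metis complex_norm_square divide_eq_eq mult.commute norm_zero of_real_1 one_power2 zero_neq_one)
  ultimately have "ipoly (reflect_poly q) z = 0"
    using conj_nonzero[OF z(1)] by (simp add: ipoly_reflect_poly)
  then have "ipoly (reflect_poly q) ib = 0" using ib_conj_sym[OF z(1)] by (simp add: is_conj_def)
  then have "ipoly q (1 / ib) = 0" using ib_nonzero by (simp add: ipoly_reflect_poly)
  then show "ipoly q (complex_of_real \<beta>) = 0" by (simp add: ib_def)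
qed

lemma conj_norm_ne_1:
  assumes z: "is_conj ib z"
  shows "norm z \<noteq> 1"
proof
  assume nz: "norm z = 1"
  obtain \<epsilon> where \<epsilon>: "\<epsilon> > 0"
    "\<And>n x. x \<in> I \<Longrightarrow> (T ^^ n) x = 0 \<Longrightarrow> x \<noteq> 0 \<Longrightarrow> \<epsilon> \<le> \<bar>ipoly (dpoly n x) \<beta>\<bar>"
    using reversed_value_away_from_0 by blast
  obtain p :: "int poly" where p: "p \<noteq> 0" "degree p \<le> 2"
    "\<bar>ipoly p (1 / \<beta>)\<bar> < min rend \<epsilon>" "\<bar>ipoly p \<beta>\<bar> < min rend \<epsilon>"
    using small_quadratic_values[of "1 / \<beta>" \<beta> "min rend \<epsilon>"] \<epsilon>(1) rend_gt_0 \<beta>_gt_1 by auto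
  define x where "x = ipoly p (1 / \<beta>)"
  have conj: "is_conj ib (of_real \<beta>)" using base_is_conj[OF z nz] .
  \<comment> \<open>Otherwise \<open>p\<close>, of degree at most 2, would vanish at 1/\<beta>,
    \<beta> and z, which are distinct because their moduli are.\<close>
  have "x \<noteq> 0"
  proof
    assume "x = 0"
    then have ib: "ipoly p ib = 0" by (simp add: ipoly_ib x_def)
    then have "ipoly p z = 0" "ipoly p (of_real \<beta> :: complex) = 0"
      using z conj by (simp_all add: is_conj_def)
    then have sub: "{ib, of_real \<beta>, z} \<subseteq> {w. poly (map_poly of_int p) w = 0}" using ib by simp
    have p0: "map_poly of_int p \<noteq> (0 :: complex poly)" using p(1) by (simp add: map_poly_eq_0_iff)
    have "card {ib, of_real \<beta>, z} \<le> card {w. poly (map_poly of_int p :: complex poly) w = 0}"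
      using sub poly_roots_finite[OF p0] by (intro card_mono) auto
    also have "\<dots> \<le> 2"
      using card_poly_roots_bound[OF p0] p(2) by (simp add: degree_map_poly)
    finally have "card {ib, of_real \<beta>, z} \<le> 2" .
    moreover have "norm ib < 1" "norm (of_real \<beta> :: complex) > 1" using \<beta>_gt_1 by (simp_all add: ib_def norm_divide)
    then have "card {ib, of_real \<beta>, z} = 3" using nz by (auto simp: card_insert_if)
    ultimately show False by simp
  qed
  have small: "\<bar>x\<bar> < rend" using p(3) by (simp add: x_def)
  then obtain n where n: "(T ^^ n) x = 0"
    using small_reaches_0 ipoly_inverse_mem x_def by blast
  \<comment> \<open>As \<beta> is a conjugate of 1/\<beta>, the equality of the two polynomials at
    1/\<beta> carries over to \<beta>.\<close>
  have "ipoly (dpoly n x) (of_real \<beta> :: complex) = ipoly p (of_real \<beta>)"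
    using conj dpoly_value[OF n] x_def by (intro conj_eqI) simp_all
  then have "ipoly (dpoly n x) \<beta> = ipoly p \<beta>" by (simp add: ipoly_of_real)
  then show False using \<epsilon>(2)[OF small_mem_I[OF small] n \<open>x \<noteq> 0\<close>] p(4) by simp
qed

lemma conj_norm_gt_1:
  assumes "is_conj ib z" "z \<noteq> ib"
  shows "norm z > 1"
  using conj_norm_ge_1[OF assms] conj_norm_ne_1[OF assms(1)] by linarith

section \<open>Uniform orbit lengths and rational points near 0\<close>

lemma finite_conj: "finite {z. is_conj ib z}"
proof -
  obtain m where m: "lead_coeff m = 1" "ipoly m ib = 0" using monic_relation by blast
  then have "m \<noteq> 0" by auto
  then show ?thesis using min_poly_exists[of m ib] m card_conjugates(1) by blast
qed

text \<open>Only finitely many points satisfy the bound on the conjugates, so the longest of their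
  orbits to 0 serves for all.\<close>

lemma bounded_conj_uniform_length:
  "\<exists>K. \<forall>x\<in>I. \<forall>n. (T ^^ n) x = 0 \<longrightarrow> (\<forall>z. is_conj ib z \<longrightarrow> norm (ipoly (dpoly n x) z) \<le> C) \<longrightarrow> (T ^^ K) x = 0"
proof -
  obtain m where m: "lead_coeff m = 1" "ipoly m ib = 0" using monic_relation by blast
  define X where "X = {x\<in>I. \<exists>n. (T ^^ n) x = 0 \<and> (\<forall>z. is_conj ib z \<longrightarrow> norm (ipoly (dpoly n x) z) \<le> C)}"
  have "(of_real :: real \<Rightarrow> complex) ` X \<subseteq> {ipoly q ib | q. \<forall>z. is_conj ib z \<longrightarrow> norm (ipoly q z) \<le> C}"
  proof
    fix y :: complex assume "y \<in> of_real ` X"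
    then obtain x n where x: "y = of_real x" "(T ^^ n) x = 0"
      "\<forall>z. is_conj ib z \<longrightarrow> norm (ipoly (dpoly n x) z) \<le> C"
      by (auto simp: X_def)
    have "y = ipoly (dpoly n x) ib" using x dpoly_value by (simp add: ipoly_ib)
    then show "y \<in> {ipoly q ib | q. \<forall>z. is_conj ib z \<longrightarrow> norm (ipoly q z) \<le> C}" using x(3) by blast
  qed
  then have "finite ((of_real :: real \<Rightarrow> complex) ` X)"
    using finite_bounded_conjugates[OF m] finite_subset by blast
  then have "finite X" by (rule finite_imageD) (simp add: inj_on_def)
  have "\<forall>x\<in>X. \<exists>n. (T ^^ n) x = 0" by (auto simp: X_def)
  then obtain len where len: "\<And>x. x \<in> X \<Longrightarrow> (T ^^ len x) x = 0" by metis
  define K where "K = Max (insert 0 (len ` X))"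
  have "(T ^^ K) x = 0" if "x \<in> X" for x
    by (rule funpow_T_zero_mono[OF len[OF that]]) (use that \<open>finite X\<close> in \<open>simp add: K_def\<close>)
  then show ?thesis by (intro exI[of _ K]) (auto simp: X_def)
qed

text \<open>Two powers of 1/\<beta> agree modulo b; cancelling the unit (1/\<beta>)^i shows that b
  divides 1 - (1/\<beta>)^N in the ring. A geometric sum extends this to all multiples of N.\<close>

lemma rational_multiple_mem:
  assumes "b > 0"
  shows "\<exists>N>0. \<forall>t. of_int a / of_int b * (1 - (1 / \<beta>) ^ (N * t)) \<in> int_poly_ring \<beta>"
proof -
  obtain m where m: "lead_coeff m = 1" "ipoly m ib = 0" using monic_relation by blast
  obtain i j q where ij: "i < j" and eq: "ib ^ j - ib ^ i = of_int b * ipoly q ib"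
    using power_congruence_mod[OF m assms] by blast
  define N where "N = j - i"
  have "complex_of_real ((1 / \<beta>) ^ j - (1 / \<beta>) ^ i) = of_real (of_int b * ipoly q (1 / \<beta>))"
    using eq unfolding ipoly_ib by (simp add: ib_def)
  then have req: "(1 / \<beta>) ^ j - (1 / \<beta>) ^ i = of_int b * ipoly q (1 / \<beta>)"
    using of_real_eq_iff by blast
  have "(1 / \<beta>) ^ N - 1 = \<beta> ^ i * ((1 / \<beta>) ^ j - (1 / \<beta>) ^ i)"
  proof -
    have "(1 / \<beta>) ^ j = (1 / \<beta>) ^ N * (1 / \<beta>) ^ i" using ij by (simp add: N_def flip: power_add)
    moreover have "\<beta> ^ i * (1 / \<beta>) ^ i = 1" using \<beta>_gt_1 by (simp flip: power_mult_distrib)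
    ultimately show ?thesis by (simp add: algebra_simps)
  qed
  then have "(1 / \<beta>) ^ N - 1 = of_int b * (\<beta> ^ i * ipoly q (1 / \<beta>))"
    unfolding req by (simp add: mult.left_commute)
  then have N1: "1 - (1 / \<beta>) ^ N = of_int b * (of_int (- 1) * (\<beta> ^ i * ipoly q (1 / \<beta>)))"
    by simp
  have "of_int a / of_int b * (1 - (1 / \<beta>) ^ (N * t)) \<in> int_poly_ring \<beta>" for t
  proof -
    have "1 - ((1 / \<beta>) ^ N) ^ t = (1 - (1 / \<beta>) ^ N) * (\<Sum>l<t. ((1 / \<beta>) ^ N) ^ l)"
      by (rule one_diff_power_eq)
    moreover have "(\<Sum>l<t. ((1 / \<beta>) ^ N) ^ l) = ipoly (\<Sum>l<t. [:0, 1:] ^ (N * l)) (1 / \<beta>)"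
      by (induction t) (simp_all add: power_mult)
    ultimately have "of_int a / of_int b * (1 - (1 / \<beta>) ^ (N * t))
        = of_int a * (of_int (- 1) * (\<beta> ^ i * ipoly q (1 / \<beta>)) * ipoly (\<Sum>l<t. [:0, 1:] ^ (N * l)) (1 / \<beta>))"
      unfolding N1 power_mult using assms by simp
    also have "\<dots> \<in> int_poly_ring \<beta>"
      by (intro int_poly_ring_closed(1,3,4) ipoly_inverse_mem)
    finally show ?thesis .
  qed
  moreover have "N > 0" using ij by (simp add: N_def)
  ultimately show ?thesis by blast
qed

text \<open>The orbit of w reaches 0 at some unknown time; the point is to reach it by time N. The
  conjugates of the iterate f at time N - K are bounded by a \<open>C\<close> that depends on
  neither x nor N, so \<open>K\<close> further steps suffice. Hence \<open>C\<close> and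
  \<open>K\<close> are fixed first and the bound on x is chosen afterwards.\<close>

lemma rational_reaches_0:
  "\<exists>c>0. \<forall>x. x \<in> \<rat> \<longrightarrow> \<bar>x\<bar> < c \<longrightarrow> (\<exists>N>0. x - x * (- 1 / \<beta>) ^ N \<in> I \<and> (T ^^ N) (x - x * (- 1 / \<beta>) ^ N) = 0)"
proof -
  let ?S = "{z. is_conj ib z}"
  define c0 where "c0 z = \<beta> * norm z / (norm z - 1)" for z :: complex
  define C where "C = 1 + (\<Sum>z\<in>?S. \<bar>c0 z\<bar>)"
  obtain K where K: "\<And>x n. x \<in> I \<Longrightarrow> (T ^^ n) x = 0
      \<Longrightarrow> (\<And>z. is_conj ib z \<Longrightarrow> norm (ipoly (dpoly n x) z) \<le> C) \<Longrightarrow> (T ^^ K) x = 0"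
    using bounded_conj_uniform_length[of C] by blast
  define R where "R = 1 + (\<Sum>z\<in>?S. norm z)"
  have R1: "R \<ge> 1" by (simp add: R_def sum_nonneg)
  have RS: "norm z \<le> R" if "is_conj ib z" for z
    using member_le_sum[of z ?S norm] that finite_conj by (simp add: R_def)
  have CS: "1 + c0 z \<le> C" if "is_conj ib z" for z
    using member_le_sum[of z ?S "\<lambda>z. \<bar>c0 z\<bar>"] that finite_conj by (simp add: C_def)
  have C1: "1 \<le> C" by (simp add: C_def sum_nonneg)
  define c where "c = min rend (1 / (2 * R ^ K))"
  have "c > 0" using rend_gt_0 R1 by (simp add: c_def)
  moreover have "\<exists>N>0. x - x * (- 1 / \<beta>) ^ N \<in> I \<and> (T ^^ N) (x - x * (- 1 / \<beta>) ^ N) = 0"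
    if "x \<in> \<rat>" and xc: "\<bar>x\<bar> < c" for x
  proof -
    obtain a b where b: "b > 0" and x: "x = of_int a / of_int b" using \<open>x \<in> \<rat>\<close> by (rule Rats_cases')
    obtain N0 where N0: "N0 > 0" "\<And>t. x * (1 - (1 / \<beta>) ^ (N0 * t)) \<in> int_poly_ring \<beta>"
      using rational_multiple_mem[OF b, of a] x by blast
    \<comment> \<open>An even exponent turns (-1/\<beta>)^N into (1/\<beta>)^N, and the factor makes
      N exceed \<open>K\<close>.\<close>
    define N where "N = N0 * (2 * Suc K)"
    define m where "m = N - K"
    have "1 * Suc K \<le> N" unfolding N_def using N0(1) by (intro mult_le_mono) auto
    then have NK: "N = m + K" and "N > 0" by (simp_all add: m_def)
    define w where "w = x * (1 - (1 / \<beta>) ^ N)"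
    have wR: "w \<in> int_poly_ring \<beta>" unfolding w_def N_def by (rule N0(2))
    have "even N" by (simp add: N_def)
    then have w': "x - x * (- 1 / \<beta>) ^ N = w"
      by (simp add: w_def power_divide algebra_simps)
    have pow1: "(1 / \<beta>) ^ N \<le> 1" "(1 / \<beta>) ^ N \<ge> 0" using \<beta>_gt_1 by (auto simp: power_le_one)
    have "\<bar>w\<bar> \<le> \<bar>x\<bar> * 1" unfolding w_def abs_mult using pow1 by (intro mult_left_mono) auto
    moreover have "\<bar>x\<bar> < rend" using xc unfolding c_def by simp
    ultimately have "\<bar>w\<bar> < rend" by simp
    then have wI: "w \<in> I" by (rule small_mem_I)
    obtain n where n: "(T ^^ n) w = 0" using small_reaches_0[OF wR \<open>\<bar>w\<bar> < rend\<close>] by blast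
    define f where "f = (T ^^ m) w"
    have fI: "f \<in> I" using wI by (simp add: f_def funpow_T_mem_I)
    have fn: "(T ^^ n) f = 0"
    proof -
      have "(T ^^ n) f = (T ^^ (n + m)) w" by (simp add: f_def funpow_add)
      then show ?thesis using funpow_T_zero_mono[OF n, of "n + m"] by simp
    qed
    have "(T ^^ K) f = 0"
    proof (rule K[OF fI fn])
      fix z assume z: "is_conj ib z"
      show "norm (ipoly (dpoly n f) z) \<le> C"
      proof (cases "z = ib")
        case True
        have "lend \<ge> - 1" using \<beta>_gt_1 by (simp add: field_simps)
        then have "\<bar>f\<bar> \<le> 1" using fI lend_lt_0 rend_eq unfolding mem_I by linarith
        then show ?thesis using True C1 dpoly_value[OF fn] by (simp add: ipoly_ib)
      next
        case False
        then have z1: "norm z > 1" using conj_norm_gt_1 z by blast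
        \<comment> \<open>w as a polynomial in 1/\<beta>: its first m digits followed by the digits
          of f. Clearing the denominator b makes p(1/\<beta>) = x (1 - (1/\<beta>)^N) an integer
          relation, which transfers to z.\<close>
        define p where "p = dpoly m w + (- [:0, 1:]) ^ m * dpoly n f"
        have "ipoly p (1 / \<beta>) = w"
          using ipoly_dpoly[of w m] dpoly_value[OF fn] by (simp add: p_def f_def)
        then have "ipoly (smult b p) (1 / \<beta>) = ipoly (smult a (1 - [:0, 1:] ^ N)) (1 / \<beta>)"
          using b by (simp add: w_def x)
        then have "ipoly (smult b p) z = ipoly (smult a (1 - [:0, 1:] ^ N)) z"
          by (rule conj_eqI[OF z])
        then have pz: "ipoly p z = of_real x * (1 - z ^ N)"
          using b by (simp add: x field_simps)
        then have "(- z) ^ m * ipoly (dpoly n f) z = of_real x * (1 - z ^ N) - ipoly (dpoly m w) z"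
          by (simp add: p_def algebra_simps)
        then have "norm z ^ m * norm (ipoly (dpoly n f) z) = norm (of_real x * (1 - z ^ N) - ipoly (dpoly m w) z)"
          by (metis norm_minus_cancel norm_mult norm_power)
        also have "\<dots> \<le> norm (of_real x * (1 - z ^ N)) + norm (ipoly (dpoly m w) z)"
          by (rule norm_triangle_ineq4)
        also have "\<dots> \<le> norm z ^ m * 1 + norm z ^ m * c0 z"
        proof (rule add_mono)
          have "norm (1 - z ^ N) \<le> 1 + norm z ^ N"
            using norm_triangle_ineq4[of 1 "z ^ N"] by (simp add: norm_power)
          also have "\<dots> \<le> 2 * norm z ^ N" using z1 by simp
          finally have "norm (of_real x * (1 - z ^ N)) \<le> \<bar>x\<bar> * (2 * norm z ^ N)"
            by (simp add: norm_mult mult_left_mono)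
          also have "\<dots> = norm z ^ m * (\<bar>x\<bar> * (2 * norm z ^ K))" by (simp add: NK power_add)
          also have "\<dots> \<le> norm z ^ m * 1"
          proof (rule mult_left_mono)
            have "\<bar>x\<bar> * (2 * norm z ^ K) \<le> 1 / (2 * R ^ K) * (2 * R ^ K)"
              using xc RS[OF z] R1 by (intro mult_mono power_mono) (auto simp: c_def)
            then show "\<bar>x\<bar> * (2 * norm z ^ K) \<le> 1" using R1 by simp
          qed simp
          finally show "norm (of_real x * (1 - z ^ N)) \<le> norm z ^ m * 1" .
          have "norm (ipoly (dpoly m w) z) \<le> (norm z ^ m - 1) * c0 z"
            unfolding c0_def by (rule ipoly_dpoly_conj_bound'[OF wI z1])
          also have "\<dots> \<le> norm z ^ m * c0 z"
            using z1 \<beta>_gt_1 by (intro mult_right_mono) (auto simp: c0_def)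
          finally show "norm (ipoly (dpoly m w) z) \<le> norm z ^ m * c0 z" .
        qed
        also have "\<dots> = norm z ^ m * (1 + c0 z)" by (simp add: algebra_simps)
        also have "\<dots> \<le> norm z ^ m * C" using CS[OF z] by (intro mult_left_mono) auto
        finally have "norm z ^ m * norm (ipoly (dpoly n f) z) \<le> norm z ^ m * C" .
        moreover have "norm z ^ m > 0" by (rule zero_less_power) (use z1 in linarith)
        ultimately show ?thesis by (rule mult_left_le_imp_le)
      qed
    qed
    then have "(T ^^ N) w = 0" by (simp add: NK f_def funpow_add add.commute[of m])
    then show ?thesis using \<open>N > 0\<close> wI w' by auto
  qed
  ultimately show ?thesis by blast
qed

end

theorem theorem14:
  fixes \<beta> :: real
  assumes "\<beta> > 1"
    and "eventually_periodic (d_neg \<beta> (- \<beta> / (\<beta> + 1)))"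
    and "\<not> ends_in_zeros (d_neg \<beta> (- \<beta> / (\<beta> + 1)))"
    and "Fin_neg \<beta> = int_poly_ring \<beta>"
  shows "\<exists>\<gamma>>0. {-\<gamma><..<\<gamma>} \<subseteq> I_beta \<beta> \<and>
           (\<forall>x\<in>{-\<gamma><..<\<gamma>}. x \<in> \<rat> \<longrightarrow> purely_periodic (d_neg \<beta> x))"
proof -
  interpret neg_base_finite \<beta> by unfold_locales fact+
  have "finite (range (\<lambda>n. (T ^^ n) lend))"
    using finite_orbit_of_eventually_periodic[OF lend_mem_I assms(2)] .
  moreover have "(T ^^ n) lend \<noteq> 0" for n
    using ends_in_zerosI[of n lend] assms(3) by blast
  ultimately obtain g where g: "g > 0"
    "\<And>j u. u \<in> I \<Longrightarrow> (T ^^ j) u = 0 \<Longrightarrow> g / \<beta> ^ j \<le> u - lend \<and> g / \<beta> ^ j \<le> rend - u"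
    using preimages_of_0_away_from_ends by blast
  obtain c where c: "c > 0" "\<And>x. x \<in> \<rat> \<Longrightarrow> \<bar>x\<bar> < c
      \<Longrightarrow> \<exists>N>0. x - x * (- 1 / \<beta>) ^ N \<in> I \<and> (T ^^ N) (x - x * (- 1 / \<beta>) ^ N) = 0"
    using rational_reaches_0 by blast
  \<comment> \<open>\<open>rend\<close> keeps the interval inside \<open>I\<close>, \<open>c\<close>
    makes the iterates of w reach 0 in time, and \<open>g\<close> allows the perturbation from w
    back to x.\<close>
  define \<gamma> where "\<gamma> = min rend (min g c)"
  have "\<gamma> > 0" using rend_gt_0 g(1) c(1) by (simp add: \<gamma>_def)
  moreover have "{-\<gamma><..<\<gamma>} \<subseteq> I"
  proof
    fix x assume "x \<in> {-\<gamma><..<\<gamma>}"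
    then have "\<bar>x\<bar> < \<gamma>" by auto
    then have "\<bar>x\<bar> < rend" by (simp add: \<gamma>_def)
    then show "x \<in> I" by (rule small_mem_I)
  qed
  moreover have "purely_periodic (d_neg \<beta> x)" if "x \<in> {-\<gamma><..<\<gamma>}" and rat: "x \<in> \<rat>" for x
  proof -
    have "\<bar>x\<bar> < \<gamma>" using that(1) by auto
    then have x: "\<bar>x\<bar> < g" "\<bar>x\<bar> < c" by (simp_all add: \<gamma>_def)
    obtain N where N: "N > 0" "x - x * (- 1 / \<beta>) ^ N \<in> I" "(T ^^ N) (x - x * (- 1 / \<beta>) ^ N) = 0"
      using c(2)[OF rat x(2)] by blast
    have "(T ^^ N) x = x" using fixed_point_of_perturbed_preimage[OF g(2) x(1) N(2,3)] by blast
    then show ?thesis using N(1) by (rule purely_periodicI)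
  qed
  ultimately show ?thesis by blast
qed

end
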